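(* Let $\mathcal{A}$ be a dual Banach algebra. Then the following statements hold: (i) if $\mathcal{A}$ is approximately Connes-biprojective and has an identity, then $\mathcal{A}$ is Johnson pseudo-Connes amenable; (ii) if $\mathcal{A}$ is Johnson pseudo-Connes amenable, then $\mathcal{A}$ is approximately Connes-biprojective.
   Context: A Banach algebra $\mathcal{A}$ is called a dual Banach algebra if there is a closed $\mathcal{A}$-submodule $\mathcal{A}_*$ of $\mathcal{A}^*$ such that $\mathcal{A}=(\mathcal{A}_* )^*$; the $wk^*$-topology on $\mathcal{A}$ is $\sigma(\mathcal{A},\mathcal{A}_* )$. For a Banach $\mathcal{A}$-bimodule $E$, the dual $E^*$ is a Banach $\mathcal{A}$-bimodule via $(a\cdot f)(x)=f(x\cdot a)$ and $(f\cdot a)(x)=f(a\cdot x)$. The projective tensor product $\mathcal{A}\hat{\otimes}\mathcal{A}$ is a Banach $\mathcal{A}$-bimodule via $a\cdot(b\otimes c)=ab\otimes c$, $(b\otimes c)\cdot a=b\otimes ca$, and $\pi_{\mathcal{A}}:\mathcal{A}\hat{\otimes}\mathcal{A}\to\mathcal{A}$ is the product morphism determined by $\pi_{\mathcal{A}}(a\otimes b)=ab$. For a Banach $\mathcal{A}$-bimodule $E$, $\sigma wc(E)$ denotes the set of all $x\in E$ such that the maps $\mathcal{A}\to E$, $a\mapsto a\cdot x$ and $a\mapsto x\cdot a$, are continuous from the $wk^*$-topology of $\mathcal{A}$ to the weak topology of $E$; it is a closed submodule of $E$. The notation $\sigma wc(\mathcal{A}\hat{\otimes}\mathcal{A})^*$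 means $\sigma wc((\mathcal{A}\hat{\otimes}\mathcal{A})^* )$. Since $\sigma wc(\mathcal{A}_* )=\mathcal{A}_*$, the adjoint $\pi_{\mathcal{A}}^*$ maps $\mathcal{A}_*$ into $\sigma wc(\mathcal{A}\hat{\otimes}\mathcal{A})^*$, and $\pi_{\sigma wc}:(\sigma wc(\mathcal{A}\hat{\otimes}\mathcal{A})^* )^*\to\mathcal{A}=(\mathcal{A}_* )^*$ denotes the adjoint of $\pi_{\mathcal{A}}^*|_{\mathcal{A}_*}$; it is an $\mathcal{A}$-bimodule morphism. $\mathcal{A}$ is approximately Connes-biprojective if there exists a (not necessarily bounded) net $(\rho_\alpha)$ of continuous $\mathcal{A}$-bimodule morphisms from $\mathcal{A}$ into $(\sigma wc(\mathcal{A}\hat{\otimes}\mathcal{A})^* )^*$ such that $\pi_{\sigma wc}\circ\rho_\alpha(a)\to a$ in norm for every $a\in\mathcal{A}$. $\mathcal{A}$ is Johnson pseudo-Connes amenable if there exists a (not necessarily bounded) net $(m_\alpha)$ in $(\mathcal{A}\hat{\otimes}\mathcal{A})^{**}$ such that $\langle T,a\cdot m_\alpha\rangle=\langle T,m_\alpha\cdot a\rangle$ for every $\alpha$ and $i_{\mathcal{A}_*}^*\pi_{\mathcal{A}}^{**}(m_\alpha)a\to a$ in norm, for every $a\in\mathcal{A}$ and every $T\in\sigma wc(\mathcal{A}\hat{\otimes}\mathcal{A})^*$, where $i_{\mathcal{A}_*}:\mathcal{A}_*\hookrightarrow\mathcal{A}^*$ is the canonical embedding (so $i_{\mathcal{A}_*}^*:\mathcal{A}^{**}\to(\mathcal{A}_*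 )^*=\mathcal{A}$). *)

theory Defs
  imports "HOL-Analysis.Analysis"
begin

section \<open>Complex normed spaces and complex Banach algebras\<close>

text \<open>The distribution only has real normed type classes, so complex scalars are added on top
  of them. No unit is assumed of a Banach algebra.\<close>

class complex_vector = real_vector +
  fixes scaleC :: "complex \<Rightarrow> 'a \<Rightarrow> 'a" (infixr \<open>*\<^sub>C\<close> 75)
  assumes scaleC_add_right: "c *\<^sub>C (x + y) = c *\<^sub>C x + c *\<^sub>C y"
    and scaleC_add_left: "(c + d) *\<^sub>C x = c *\<^sub>C x + d *\<^sub>C x"
    and scaleC_scaleC: "c *\<^sub>C d *\<^sub>C x = (c * d) *\<^sub>C x"
    and scaleR_scaleC: "r *\<^sub>R x = complex_of_real r *\<^sub>C x"

class complex_normed_vector = complex_vector + real_normed_vector +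
  assumes norm_scaleC: "norm (c *\<^sub>C x) = cmod c * norm x"

class complex_banach = complex_normed_vector + banach

class complex_banach_algebra = complex_banach + real_normed_algebra +
  assumes mult_scaleC_left: "(c *\<^sub>C x) * y = c *\<^sub>C (x * y)"
    and mult_scaleC_right: "x * (c *\<^sub>C y) = c *\<^sub>C (x * y)"

instantiation complex :: complex_banach_algebra
begin

definition scaleC_complex :: "complex \<Rightarrow> complex \<Rightarrow> complex"
  where [simp]: "scaleC_complex c x = c * x"

instance
  by standard (auto simp: algebra_simps norm_mult scaleR_conv_of_real)

end

lemma scaleC_zero_right [simp]: "c *\<^sub>C 0 = (0::'a::complex_vector)"
  using scaleC_add_right[of c "0::'a" 0] by simp

lemma scaleC_minus_one: "(- 1) *\<^sub>C x = - (x::'a::complex_vector)"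
  using scaleR_scaleC[of "-1" x] by simp

definition csubspace :: "'a::complex_vector set \<Rightarrow> bool"
  where "csubspace S \<longleftrightarrow> 0 \<in> S \<and> (\<forall>x\<in>S. \<forall>y\<in>S. x + y \<in> S) \<and> (\<forall>c. \<forall>x\<in>S. c *\<^sub>C x \<in> S)"

definition bounded_clinear :: "('a::complex_normed_vector \<Rightarrow> 'b::complex_normed_vector) \<Rightarrow> bool"
  where "bounded_clinear f \<longleftrightarrow> bounded_linear f \<and> (\<forall>c x. f (c *\<^sub>C x) = c *\<^sub>C f x)"

definition bounded_cbilinear ::
    "('a::complex_normed_vector \<Rightarrow> 'b::complex_normed_vector \<Rightarrow> 'c::complex_normed_vector) \<Rightarrow> bool"
  where "bounded_cbilinear B \<longleftrightarrow> bounded_bilinear B \<and>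
    (\<forall>c x y. B (c *\<^sub>C x) y = c *\<^sub>C B x y \<and> B x (c *\<^sub>C y) = c *\<^sub>C B x y)"

lemma bounded_clinearI:
  assumes "\<And>x y. f (x + y) = f x + f y" "\<And>c x. f (c *\<^sub>C x) = c *\<^sub>C f x"
    and "\<And>x. norm (f x) \<le> norm x * K"
  shows "bounded_clinear f"
  unfolding bounded_clinear_def
  by (intro conjI bounded_linear_intro allI) (use assms in \<open>auto simp: scaleR_scaleC\<close>)

lemma bounded_cbilinearI:
  assumes "\<And>x y z. B (x + y) z = B x z + B y z" "\<And>x y z. B x (y + z) = B x y + B x z"
    and "\<And>c x y. B (c *\<^sub>C x) y = c *\<^sub>C B x y" "\<And>c x y. B x (c *\<^sub>C y) = c *\<^sub>C B x y"
    and "\<And>x y. norm (B x y) \<le> norm x * norm y * K"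
  shows "bounded_cbilinear B"
  unfolding bounded_cbilinear_def
proof (intro conjI allI)
  show "bounded_bilinear B"
    by (rule bounded_bilinear.intro) (use assms in \<open>auto simp: scaleR_scaleC\<close>)
qed (use assms in auto)

lemma bounded_cbilinear_bound:
  assumes "bounded_cbilinear B"
  obtains K where "0 \<le> K" "\<And>x y. norm (B x y) \<le> norm x * norm y * K"
  using assms bounded_bilinear.nonneg_bounded unfolding bounded_cbilinear_def by blast

lemma bounded_clinear_bound:
  assumes "bounded_clinear f"
  obtains K where "0 \<le> K" "\<And>x. norm (f x) \<le> norm x * K"
  using assms bounded_linear.nonneg_bounded unfolding bounded_clinear_def by blast


section \<open>Dual spaces\<close>

typedef (overloaded) 'a cdual = "{f :: 'a::complex_normed_vector \<Rightarrow> complex. bounded_clinear f}"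
  morphisms cdual_apply Cdual
  by (rule exI[of _ "\<lambda>_. 0"]) (auto intro: bounded_clinearI[of _ 0])

setup_lifting type_definition_cdual

lemma cdual_apply_Cdual: "bounded_clinear f \<Longrightarrow> cdual_apply (Cdual f) = f"
  by (simp add: Cdual_inverse)

lemma cdual_eqI: "(\<And>x. cdual_apply f x = cdual_apply g x) \<Longrightarrow> f = g"
  by transfer auto

instantiation cdual :: (complex_normed_vector) complex_normed_vector
begin

lift_definition norm_cdual :: "'a cdual \<Rightarrow> real" is onorm .

lift_definition zero_cdual :: "'a cdual" is "\<lambda>_. 0"
  by (auto intro: bounded_clinearI[of _ 0])

lift_definition plus_cdual :: "'a cdual \<Rightarrow> 'a cdual \<Rightarrow> 'a cdual" is "\<lambda>f g x. f x + g x"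
  by (auto simp: bounded_clinear_def bounded_linear_add algebra_simps)

lift_definition minus_cdual :: "'a cdual \<Rightarrow> 'a cdual \<Rightarrow> 'a cdual" is "\<lambda>f g x. f x - g x"
  by (auto simp: bounded_clinear_def bounded_linear_sub algebra_simps)

lift_definition uminus_cdual :: "'a cdual \<Rightarrow> 'a cdual" is "\<lambda>f x. - f x"
  by (auto simp: bounded_clinear_def bounded_linear_minus)

lift_definition scaleC_cdual :: "complex \<Rightarrow> 'a cdual \<Rightarrow> 'a cdual" is "\<lambda>c f x. c * f x"
  by (auto simp: bounded_clinear_def bounded_linear_const_mult algebra_simps)

definition scaleR_cdual :: "real \<Rightarrow> 'a cdual \<Rightarrow> 'a cdual"
  where "scaleR_cdual r f = complex_of_real r *\<^sub>C f"

definition dist_cdual :: "'a cdual \<Rightarrow> 'a cdual \<Rightarrow> real"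
  where "dist_cdual f g = norm (f - g)"

definition uniformity_cdual :: "('a cdual \<times> 'a cdual) filter"
  where "uniformity_cdual = (INF e\<in>{0 <..}. principal {(x, y). dist x y < e})"

definition open_cdual :: "'a cdual set \<Rightarrow> bool"
  where "open_cdual S = (\<forall>x\<in>S. \<forall>\<^sub>F (x', y) in uniformity. x' = x \<longrightarrow> y \<in> S)"

definition sgn_cdual :: "'a cdual \<Rightarrow> 'a cdual"
  where "sgn_cdual x = scaleR (inverse (norm x)) x"

lemma norm_scaleC_cdual_le: "norm (c *\<^sub>C f) \<le> cmod c * norm (f::'a cdual)"
  apply transfer
  subgoal for c f
    apply (rule onorm_bound)
    using onorm[of f] onorm_pos_le[of f]
     apply (auto simp: bounded_clinear_def norm_mult mult.assoc intro!: mult_left_mono)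
    done
  done

instance
proof
  fix f g h :: "'a cdual" and c d :: complex and r s :: real
  show "f + g + h = f + (g + h)" "f + g = g + f" "0 + f = f" "- f + f = 0" "f - g = f + - g"
    by (transfer; simp add: fun_eq_iff)+
  show "c *\<^sub>C (f + g) = c *\<^sub>C f + c *\<^sub>C g" "(c + d) *\<^sub>C f = c *\<^sub>C f + d *\<^sub>C f"
    "c *\<^sub>C d *\<^sub>C f = (c * d) *\<^sub>C f"
    by (transfer; simp add: fun_eq_iff algebra_simps)+
  show "r *\<^sub>R f = complex_of_real r *\<^sub>C f" by (rule scaleR_cdual_def)
  show "r *\<^sub>R (f + g) = r *\<^sub>R f + r *\<^sub>R g" "(r + s) *\<^sub>R f = r *\<^sub>R f + s *\<^sub>R f"
    "r *\<^sub>R s *\<^sub>R f = (r * s) *\<^sub>R f" "1 *\<^sub>R f = f"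
    unfolding scaleR_cdual_def by (transfer; simp add: fun_eq_iff algebra_simps)+
  show "dist f g = norm (f - g)" by (rule dist_cdual_def)
  show "(uniformity :: ('a cdual \<times> 'a cdual) filter) = (INF e\<in>{0 <..}. principal {(x, y). dist x y < e})"
    by (rule uniformity_cdual_def)
  show "open U = (\<forall>x\<in>U. \<forall>\<^sub>F (x', y) in uniformity. x' = x \<longrightarrow> y \<in> U)" for U :: "'a cdual set"
    by (rule open_cdual_def)
  show "sgn f = inverse (norm f) *\<^sub>R f" by (rule sgn_cdual_def)
  show "(norm f = 0) = (f = 0)"
    by transfer (auto simp: bounded_clinear_def onorm_eq_0 fun_eq_iff)
  show "norm (f + g) \<le> norm f + norm g"
    by transfer (auto simp: bounded_clinear_def intro: onorm_triangle)
  show *: "norm (c *\<^sub>C f) = cmod c * norm f" for c and f :: "'a cdual"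
  proof (rule antisym)
    show "cmod c * norm f \<le> norm (c *\<^sub>C f)"
    proof (cases "c = 0")
      case True
      have "0 \<le> norm (c *\<^sub>C f)" by transfer (auto simp: bounded_clinear_def intro!: onorm_pos_le bounded_linear_const_mult)
      with True show ?thesis by simp
    next
      case False
      have "f = inverse c *\<^sub>C (c *\<^sub>C f)"
        using False by transfer (auto simp: fun_eq_iff)
      then have "norm f \<le> cmod (inverse c) * norm (c *\<^sub>C f)"
        by (metis norm_scaleC_cdual_le)
      then have "cmod c * norm f \<le> cmod c * (cmod (inverse c) * norm (c *\<^sub>C f))"
        by (rule mult_left_mono) simp
      then show ?thesis using False by (simp add: norm_inverse mult.assoc[symmetric])
    qed
  qed (rule norm_scaleC_cdual_le)
  show "norm (r *\<^sub>R f) = \<bar>r\<bar> * norm f"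
    unfolding scaleR_cdual_def by (simp add: *)
qed

end

lemma cdual_apply_bound: "cmod (cdual_apply f x) \<le> norm f * norm x"
  by transfer (auto simp: bounded_clinear_def intro: onorm)

lemma norm_cdual_le: "0 \<le> K \<Longrightarrow> (\<And>x. cmod (cdual_apply f x) \<le> K * norm x) \<Longrightarrow> norm f \<le> K"
  by transfer (rule onorm_bound)

lemma bounded_clinear_cdual_apply: "bounded_clinear (cdual_apply f)"
  using cdual_apply by blast

lemma cdual_apply_add: "cdual_apply f (x + y) = cdual_apply f x + cdual_apply f y"
  and cdual_apply_scaleC: "cdual_apply f (c *\<^sub>C x) = c * cdual_apply f x"
  using bounded_clinear_cdual_apply[of f]
  by (auto simp: bounded_clinear_def linear_simps)

instance cdual :: (complex_normed_vector) complex_banach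
proof
  fix X :: "nat \<Rightarrow> 'a cdual" assume X: "Cauchy X"
  have *: "cmod (cdual_apply (X m) x - cdual_apply (X n) x) \<le> norm (X m - X n) * norm x" for m n x
    using cdual_apply_bound[of "X m - X n" x] by (simp add: minus_cdual.rep_eq)
  have bd: "bounded_linear (\<lambda>f. cdual_apply f x)" for x :: 'a
    by (rule bounded_linear_intro[of _ "norm x"])
      (auto simp: plus_cdual.rep_eq scaleR_cdual_def scaleC_cdual.rep_eq cdual_apply_bound
        scaleR_conv_of_real)
  have "Cauchy (\<lambda>n. cdual_apply (X n) x)" for x
    using bounded_linear.Cauchy[OF bd X] .
  then have "\<forall>x. \<exists>L. (\<lambda>n. cdual_apply (X n) x) \<longlonglongrightarrow> L"
    using Cauchy_convergent unfolding convergent_def by blast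
  then obtain g where g: "\<And>x. (\<lambda>n. cdual_apply (X n) x) \<longlonglongrightarrow> g x"
    using choice[of "\<lambda>x L. (\<lambda>n. cdual_apply (X n) x) \<longlonglongrightarrow> L"] by blast
  obtain K where K: "\<And>n. norm (X n) \<le> K"
    using Cauchy_Bseq[OF X] unfolding Bseq_def by blast
  have "bounded_clinear g"
  proof (rule bounded_clinearI)
    show "g (x + y) = g x + g y" for x y
      by (rule LIMSEQ_unique[OF g])
        (use tendsto_add[OF g[of x] g[of y]] in \<open>simp add: cdual_apply_add\<close>)
    show "g (c *\<^sub>C x) = c *\<^sub>C g x" for c x
      by (rule LIMSEQ_unique[OF g])
        (use tendsto_mult_left[OF g[of x], of c] in \<open>simp add: cdual_apply_scaleC\<close>)
    show "cmod (g x) \<le> norm x * K" for x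
    proof (rule LIMSEQ_le_const2[OF tendsto_norm[OF g]])
      have "cmod (cdual_apply (X n) x) \<le> norm x * K" for n
        using cdual_apply_bound[of "X n" x] mult_right_mono[OF K[of n] norm_ge_zero[of x]]
        by (simp add: mult.commute)
      then show "\<exists>N. \<forall>n\<ge>N. cmod (cdual_apply (X n) x) \<le> norm x * K" by blast
    qed
  qed
  then have G: "cdual_apply (Cdual g) = g" by (rule cdual_apply_Cdual)
  have "X \<longlonglongrightarrow> Cdual g"
  proof (rule LIMSEQ_I)
    fix r :: real assume r: "0 < r"
    obtain N where N: "\<And>m n. m \<ge> N \<Longrightarrow> n \<ge> N \<Longrightarrow> norm (X m - X n) < r / 2"
      using CauchyD[OF X, of "r/2"] r by auto
    have "norm (X n - Cdual g) \<le> r / 2" if n: "n \<ge> N" for n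
    proof (rule norm_cdual_le)
      fix x
      have "(\<lambda>m. cmod (cdual_apply (X n) x - cdual_apply (X m) x))
          \<longlonglongrightarrow> cmod (cdual_apply (X n) x - g x)"
        by (intro tendsto_intros g)
      then have "cmod (cdual_apply (X n) x - g x) \<le> r / 2 * norm x"
      proof (rule LIMSEQ_le_const2)
        have "cmod (cdual_apply (X n) x - cdual_apply (X m) x) \<le> r / 2 * norm x" if "m \<ge> N" for m
          using *[of n x m] mult_right_mono[OF less_imp_le[OF N[OF n that]] norm_ge_zero[of x]]
          by linarith
        then show "\<exists>M. \<forall>m\<ge>M. cmod (cdual_apply (X n) x - cdual_apply (X m) x) \<le> r / 2 * norm x"
          by blast
      qed
      then show "cmod (cdual_apply (X n - Cdual g) x) \<le> r / 2 * norm x"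
        by (simp add: minus_cdual.rep_eq G)
    qed (use r in simp)
    then show "\<exists>no. \<forall>n\<ge>no. norm (X n - Cdual g) < r"
      using r by (intro exI[of _ N]) (smt (verit) field_sum_of_halves)
  qed
  then show "convergent X" by (auto simp: convergent_def)
qed

text \<open>The adjoint \<open>T\<^sup>*\<close> of a bounded linear map \<open>T\<close>.\<close>

definition cadjoint ::
    "('a::complex_normed_vector \<Rightarrow> 'b::complex_normed_vector) \<Rightarrow> 'b cdual \<Rightarrow> 'a cdual"
  where "cadjoint T f = Cdual (\<lambda>x. cdual_apply f (T x))"

text \<open>The dual of a linear subspace \<open>S\<close>. A subspace is a set and not a type here, so its
  functionals are functions that are \<^const>\<open>undefined\<close> outside \<open>S\<close>.\<close>

definition dual_on :: "'e::complex_normed_vector set \<Rightarrow> ('e \<Rightarrow> complex) set"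
  where "dual_on S = {\<phi> \<in> extensional S.
    (\<forall>x\<in>S. \<forall>y\<in>S. \<phi> (x + y) = \<phi> x + \<phi> y) \<and>
    (\<forall>c. \<forall>x\<in>S. \<phi> (c *\<^sub>C x) = c * \<phi> x) \<and>
    (\<exists>K. \<forall>x\<in>S. cmod (\<phi> x) \<le> K * norm x)}"

definition dual_norm_on :: "'e::complex_normed_vector set \<Rightarrow> ('e \<Rightarrow> complex) \<Rightarrow> real"
  where "dual_norm_on S \<phi> = (SUP x\<in>{x\<in>S. norm x \<le> 1}. cmod (\<phi> x))"

text \<open>The topology \<open>\<sigma>(E, F)\<close> for a set \<open>F\<close> of functionals on \<open>E\<close>.\<close>

definition sigma_topology :: "'e::complex_normed_vector cdual set \<Rightarrow> 'e topology"
  where "sigma_topology F =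
    topology_generated_by {cdual_apply f -` U | f U. f \<in> F \<and> open U}"


section \<open>Banach bimodules\<close>

text \<open>\<open>l a x\<close> is \<open>a \<cdot> x\<close> and \<open>r x a\<close> is \<open>x \<cdot> a\<close>.\<close>

locale banach_bimodule =
  fixes l :: "'a::complex_banach_algebra \<Rightarrow> 'e::complex_banach \<Rightarrow> 'e"
    and r :: "'e \<Rightarrow> 'a \<Rightarrow> 'e"
  assumes bounded_left: "bounded_cbilinear l"
    and bounded_right: "bounded_cbilinear r"
    and left_assoc: "l (a * b) x = l a (l b x)"
    and right_assoc: "r x (a * b) = r (r x a) b"
    and middle_assoc: "l a (r x b) = r (l a x) b"

text \<open>The actions on the dual: \<open>(a \<cdot> f)(x) = f(x \<cdot> a)\<close> and \<open>(f \<cdot> a)(x) = f(a \<cdot> x)\<close>.\<close>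

definition dual_left :: "('e \<Rightarrow> 'a \<Rightarrow> 'e) \<Rightarrow> 'a \<Rightarrow> 'e::complex_normed_vector cdual \<Rightarrow> 'e cdual"
  where "dual_left r a f = Cdual (\<lambda>x. cdual_apply f (r x a))"

definition dual_right :: "('a \<Rightarrow> 'e \<Rightarrow> 'e) \<Rightarrow> 'e::complex_normed_vector cdual \<Rightarrow> 'a \<Rightarrow> 'e cdual"
  where "dual_right l f a = Cdual (\<lambda>x. cdual_apply f (l a x))"

text \<open>The same actions on the dual of a submodule \<open>S\<close>.\<close>

definition dual_left_on ::
    "'e set \<Rightarrow> ('e \<Rightarrow> 'a \<Rightarrow> 'e) \<Rightarrow> 'a \<Rightarrow> ('e \<Rightarrow> complex) \<Rightarrow> ('e \<Rightarrow> complex)"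
  where "dual_left_on S r a \<phi> = (\<lambda>x\<in>S. \<phi> (r x a))"

definition dual_right_on ::
    "'e set \<Rightarrow> ('a \<Rightarrow> 'e \<Rightarrow> 'e) \<Rightarrow> ('e \<Rightarrow> complex) \<Rightarrow> 'a \<Rightarrow> ('e \<Rightarrow> complex)"
  where "dual_right_on S l \<phi> a = (\<lambda>x\<in>S. \<phi> (l a x))"

lemma cdual_apply_dual_left:
  assumes "bounded_cbilinear r"
  shows "cdual_apply (dual_left r a f) x = cdual_apply f (r x a)"
proof -
  obtain K where K: "0 \<le> K" "\<And>x y. norm (r x y) \<le> norm x * norm y * K"
    using bounded_cbilinear_bound[OF assms] by blast
  have "bounded_clinear (\<lambda>x. cdual_apply f (r x a))"
  proof (rule bounded_clinearI)
    show "cmod (cdual_apply f (r x a)) \<le> norm x * (norm a * K * norm f)" for x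
      using cdual_apply_bound[of f "r x a"] mult_right_mono[OF K(2)[of x a] norm_ge_zero[of f]]
      by (simp add: mult_ac)
  qed (use assms in \<open>auto simp: bounded_cbilinear_def bounded_bilinear.add_left cdual_apply_add
      cdual_apply_scaleC\<close>)
  then show ?thesis unfolding dual_left_def by (simp add: cdual_apply_Cdual)
qed

lemma cdual_apply_dual_right:
  assumes "bounded_cbilinear l"
  shows "cdual_apply (dual_right l f a) x = cdual_apply f (l a x)"
proof -
  obtain K where K: "0 \<le> K" "\<And>x y. norm (l x y) \<le> norm x * norm y * K"
    using bounded_cbilinear_bound[OF assms] by blast
  have "bounded_clinear (\<lambda>x. cdual_apply f (l a x))"
  proof (rule bounded_clinearI)
    show "cmod (cdual_apply f (l a x)) \<le> norm x * (norm a * K * norm f)" for x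
      using cdual_apply_bound[of f "l a x"] mult_right_mono[OF K(2)[of a x] norm_ge_zero[of f]]
      by (simp add: mult_ac)
  qed (use assms in \<open>auto simp: bounded_cbilinear_def bounded_bilinear.add_right cdual_apply_add
      cdual_apply_scaleC\<close>)
  then show ?thesis unfolding dual_right_def by (simp add: cdual_apply_Cdual)
qed

lemma banach_bimodule_algebra: "banach_bimodule (*) ((*) :: 'a::complex_banach_algebra \<Rightarrow> _)"
proof -
  have "bounded_cbilinear ((*) :: 'a \<Rightarrow> _)"
    by (auto simp: bounded_cbilinear_def bounded_bilinear_mult mult_scaleC_left mult_scaleC_right)
  then show ?thesis by unfold_locales (auto simp: mult.assoc)
qed

lemma banach_bimodule_dual:
  assumes "banach_bimodule l r"
  shows "banach_bimodule (dual_left r) (dual_right l)"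
proof -
  interpret banach_bimodule l r by fact
  note L = cdual_apply_dual_left[OF bounded_right] and R = cdual_apply_dual_right[OF bounded_left]
  obtain K where K: "0 \<le> K" "\<And>x y. norm (l x y) \<le> norm x * norm y * K"
    using bounded_cbilinear_bound[OF bounded_left] by blast
  obtain K' where K': "0 \<le> K'" "\<And>x y. norm (r x y) \<le> norm x * norm y * K'"
    using bounded_cbilinear_bound[OF bounded_right] by blast
  show ?thesis
  proof
    show "bounded_cbilinear (dual_left r)"
    proof (rule bounded_cbilinearI)
      show "norm (dual_left r a f) \<le> norm a * norm f * K'" for a f
      proof (rule norm_cdual_le)
        show "cmod (cdual_apply (dual_left r a f) x) \<le> norm a * norm f * K' * norm x" for x
          using cdual_apply_bound[of f "r x a"] mult_right_mono[OF K'(2)[of x a] norm_ge_zero[of f]]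
          by (simp add: L mult_ac)
      qed (use K' in simp)
    qed (use bounded_right in \<open>auto intro!: cdual_eqI simp: L plus_cdual.rep_eq scaleC_cdual.rep_eq
        bounded_cbilinear_def bounded_bilinear.add_right cdual_apply_add cdual_apply_scaleC\<close>)
    show "bounded_cbilinear (dual_right l)"
    proof (rule bounded_cbilinearI)
      show "norm (dual_right l f a) \<le> norm f * norm a * K" for a f
      proof (rule norm_cdual_le)
        show "cmod (cdual_apply (dual_right l f a) x) \<le> norm f * norm a * K * norm x" for x
          using cdual_apply_bound[of f "l a x"] mult_right_mono[OF K(2)[of a x] norm_ge_zero[of f]]
          by (simp add: R mult_ac)
      qed (use K in simp)
    qed (use bounded_left in \<open>auto intro!: cdual_eqI simp: R plus_cdual.rep_eq scaleC_cdual.rep_eq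
        bounded_cbilinear_def bounded_bilinear.add_left cdual_apply_add cdual_apply_scaleC\<close>)
  qed (auto intro!: cdual_eqI simp: L R left_assoc right_assoc middle_assoc)
qed

section \<open>The projective tensor product\<close>

text \<open>Following Grothendieck, the completed tensor product consists of the sums
  \<open>\<Sum>n. x\<^sub>n \<otimes> y\<^sub>n\<close> with \<open>\<Sum>n. \<parallel>x\<^sub>n\<parallel> \<parallel>y\<^sub>n\<parallel> < \<infinity>\<close>, and its norm is the infimum of
  \<open>\<Sum>n. \<parallel>x\<^sub>n\<parallel> \<parallel>y\<^sub>n\<parallel>\<close> over all such representations. Two series represent the same element iff
  they agree on all bounded bilinear forms, \<open>x \<otimes> y\<close> being the functional
  \<open>B \<mapsto> B x y\<close>. This is the completion of the algebraic tensor product in the projective norm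
  (Ryan, Introduction to Tensor Products of Banach Spaces, Section 2.1).\<close>

definition tensor_series ::
    "(nat \<Rightarrow> 'a::complex_normed_vector) \<Rightarrow> (nat \<Rightarrow> 'b::complex_normed_vector) \<Rightarrow>
     ('a \<Rightarrow> 'b \<Rightarrow> complex) \<Rightarrow> complex"
  where "tensor_series x y = (\<lambda>B. if bounded_cbilinear B then (\<Sum>n. B (x n) (y n)) else 0)"

typedef (overloaded) ('a, 'b) ptensor =
  "{u :: ('a::complex_normed_vector \<Rightarrow> 'b::complex_normed_vector \<Rightarrow> complex) \<Rightarrow> complex.
     \<exists>x y. summable (\<lambda>n. norm (x n) * norm (y n)) \<and> u = tensor_series x y}"
  morphisms ptensor_apply Ptensor
  by (rule exI[of _ "tensor_series (\<lambda>_. 0) (\<lambda>_. 0)"]) (auto intro!: exI[of _ "\<lambda>_. 0"])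

setup_lifting type_definition_ptensor

definition ptensor_rep ::
    "('a::complex_normed_vector, 'b::complex_normed_vector) ptensor \<Rightarrow> (nat \<Rightarrow> 'a) \<Rightarrow> (nat \<Rightarrow> 'b) \<Rightarrow> bool"
  where "ptensor_rep u x y \<longleftrightarrow>
    summable (\<lambda>n. norm (x n) * norm (y n)) \<and> ptensor_apply u = tensor_series x y"

lemma ptensor_eqI:
  "(\<And>B. bounded_cbilinear B \<Longrightarrow> ptensor_apply u B = ptensor_apply v B) \<Longrightarrow> u = v"
proof transfer
  fix u v :: "('a \<Rightarrow> 'b \<Rightarrow> complex) \<Rightarrow> complex"
  assume uv: "\<exists>x y. summable (\<lambda>n. norm (x n) * norm (y n)) \<and> u = tensor_series x y"
    "\<exists>x y. summable (\<lambda>n. norm (x n) * norm (y n)) \<and> v = tensor_series x y"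
    and eq: "\<And>B. bounded_cbilinear B \<Longrightarrow> u B = v B"
  have "u B = v B" for B
    using uv eq[of B] by (cases "bounded_cbilinear B") (auto simp: tensor_series_def)
  then show "u = v" by blast
qed

lemma summable_bilinear:
  fixes B :: "'a::complex_normed_vector \<Rightarrow> 'b::complex_normed_vector \<Rightarrow> 'c::complex_normed_vector"
  assumes "bounded_cbilinear B" "summable (\<lambda>n. norm (x n) * norm (y n))"
  shows "summable (\<lambda>n. norm (B (x n) (y n)))"
proof -
  obtain K where K: "0 \<le> K" "\<And>x y. norm (B x y) \<le> norm x * norm y * K"
    using bounded_cbilinear_bound[OF assms(1)] by blast
  show ?thesis
    by (rule summable_comparison_test'[OF summable_mult2[OF assms(2), of K]]) (use K in auto)
qed

lemma tensor_series_double: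
  fixes X :: "nat \<Rightarrow> nat \<Rightarrow> 'a::complex_normed_vector"
    and Y :: "nat \<Rightarrow> nat \<Rightarrow> 'b::complex_normed_vector"
  assumes XY: "\<And>k. summable (\<lambda>n. norm (X k n) * norm (Y k n))"
    and s: "summable (\<lambda>k. \<Sum>n. norm (X k n) * norm (Y k n))"
  obtains x y where "(\<lambda>n. norm (x n) * norm (y n)) sums (\<Sum>k. \<Sum>n. norm (X k n) * norm (Y k n))"
    and "\<And>B. bounded_cbilinear B \<Longrightarrow>
      (\<lambda>k. tensor_series (X k) (Y k) B) sums tensor_series x y B"
proof -
  define x where "x = (\<lambda>m. case prod_decode m of (k, n) \<Rightarrow> X k n)"
  define y where "y = (\<lambda>m. case prod_decode m of (k, n) \<Rightarrow> Y k n)"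
  define f where "f = (\<lambda>(k, n). norm (X k n) * norm (Y k n))"
  define S where "S = (\<Sum>k. \<Sum>n. norm (X k n) * norm (Y k n))"
  have inner: "((\<lambda>n. f (k, n)) has_sum (\<Sum>n. norm (X k n) * norm (Y k n))) UNIV" for k
    unfolding f_def by (simp, rule sums_nonneg_imp_has_sum[OF summable_sums[OF XY]]) auto
  have outer: "((\<lambda>k. \<Sum>n. norm (X k n) * norm (Y k n)) has_sum S) UNIV"
    unfolding S_def
    by (rule sums_nonneg_imp_has_sum[OF summable_sums[OF s]]) (intro suminf_nonneg XY, auto)
  have fsum: "f summable_on (UNIV \<times> UNIV)"
    by (rule summable_on_SigmaI[OF inner]) (use outer in \<open>auto simp: summable_on_def f_def\<close>)
  have fS: "(f has_sum S) (UNIV \<times> UNIV)"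
    by (rule has_sum_SigmaI[OF inner outer fsum])
  have reindex: "((\<lambda>m. g (prod_decode m)) has_sum L) UNIV \<longleftrightarrow> (g has_sum L) (UNIV \<times> UNIV)"
    for g :: "nat \<times> nat \<Rightarrow> 'z::banach" and L
    using has_sum_reindex_bij_betw[OF bij_prod_decode, of g L] by simp
  have f_xy: "f (prod_decode m) = norm (x m) * norm (y m)" for m
    by (simp add: f_def x_def y_def split: prod.split)
  have 1: "(\<lambda>n. norm (x n) * norm (y n)) sums S"
    using has_sum_imp_sums reindex[of f S] fS f_xy by auto
  have 2: "(\<lambda>k. tensor_series (X k) (Y k) B) sums tensor_series x y B" if B: "bounded_cbilinear B"
    for B :: "'a \<Rightarrow> 'b \<Rightarrow> complex"
  proof -
    define g where "g = (\<lambda>(k, n). B (X k n) (Y k n))"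
    have g_xy: "g (prod_decode m) = B (x m) (y m)" for m
      by (simp add: g_def x_def y_def split: prod.split)
    have s: "summable (\<lambda>n. norm (B (x n) (y n)))"
      using summable_bilinear[OF B sums_summable[OF 1]] .
    have "((\<lambda>m. B (x m) (y m)) has_sum (\<Sum>n. B (x n) (y n))) UNIV"
      using norm_summable_imp_has_sum[OF s summable_sums[OF summable_norm_cancel[OF s]]] .
    then have G: "(g has_sum tensor_series x y B) (UNIV \<times> UNIV)"
      using reindex[of g] B by (simp add: g_xy tensor_series_def)
    have I: "((\<lambda>n. g (k, n)) has_sum tensor_series (X k) (Y k) B) UNIV" for k
      using norm_summable_imp_has_sum[OF summable_bilinear[OF B XY[of k]]]
        summable_sums[OF summable_norm_cancel[OF summable_bilinear[OF B XY[of k]]]] B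
      by (simp add: g_def tensor_series_def)
    have "((\<lambda>k. tensor_series (X k) (Y k) B) has_sum tensor_series x y B) UNIV"
      by (rule has_sum_SigmaD[OF G I])
    then show ?thesis by (rule has_sum_imp_sums)
  qed
  show ?thesis using that 1 2 unfolding S_def by blast
qed

lemma tensor_series_add:
  fixes x x' :: "nat \<Rightarrow> 'a::complex_normed_vector" and y y' :: "nat \<Rightarrow> 'b::complex_normed_vector"
  assumes "summable (\<lambda>n. norm (x n) * norm (y n))" "summable (\<lambda>n. norm (x' n) * norm (y' n))"
  obtains z w where "(\<lambda>n. norm (z n) * norm (w n)) sums
      ((\<Sum>n. norm (x n) * norm (y n)) + (\<Sum>n. norm (x' n) * norm (y' n)))"
    and "tensor_series z w = (\<lambda>B. tensor_series x y B + tensor_series x' y' B)"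
proof -
  define X where "X = (\<lambda>k::nat. if k = 0 then x else if k = 1 then x' else (\<lambda>_. 0))"
  define Y where "Y = (\<lambda>k::nat. if k = 0 then y else if k = 1 then y' else (\<lambda>_. 0))"
  have [simp]: "{k. k < Suc 0} = {0}" by auto
  have two: "h sums (h 0 + h 1)" if "\<And>k. k \<ge> 2 \<Longrightarrow> h k = 0" for h :: "nat \<Rightarrow> 'z::real_normed_vector"
    using sums_finite[of "{0, 1}" h] that by (auto simp: numeral_2_eq_2)
  have *: "(\<lambda>k. \<Sum>n. norm (X k n) * norm (Y k n)) sums
      ((\<Sum>n. norm (x n) * norm (y n)) + (\<Sum>n. norm (x' n) * norm (y' n)))"
    using two[of "\<lambda>k. \<Sum>n. norm (X k n) * norm (Y k n)"] by (simp add: X_def Y_def)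
  have "summable (\<lambda>n. norm (X k n) * norm (Y k n))" for k
    using assms by (simp add: X_def Y_def)
  then obtain z w where zw: "(\<lambda>n. norm (z n) * norm (w n)) sums
      (\<Sum>k. \<Sum>n. norm (X k n) * norm (Y k n))"
    "\<And>B. bounded_cbilinear B \<Longrightarrow> (\<lambda>k. tensor_series (X k) (Y k) B) sums tensor_series z w B"
    using tensor_series_double[of X Y] sums_summable[OF *] by blast
  have "tensor_series z w B = tensor_series x y B + tensor_series x' y' B" for B
  proof (cases "bounded_cbilinear B")
    case True
    have zero: "B 0 0 = 0"
      using True by (auto simp: bounded_cbilinear_def bounded_bilinear.zero_left)
    have "(\<lambda>k. tensor_series (X k) (Y k) B) sums (tensor_series x y B + tensor_series x' y' B)"
      using two[of "\<lambda>k. tensor_series (X k) (Y k) B"]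
      by (simp add: X_def Y_def tensor_series_def zero)
    then show ?thesis using zw(2)[OF True] sums_unique2 by blast
  qed (simp add: tensor_series_def)
  then show ?thesis using that zw(1) sums_unique[OF *] by presburger
qed

lemma tensor_series_scaleC:
  assumes "summable (\<lambda>n. norm (x n) * norm (y n))"
  shows "summable (\<lambda>n. norm (c *\<^sub>C x n) * norm (y n))"
    and "(\<Sum>n. norm (c *\<^sub>C x n) * norm (y n)) = cmod c * (\<Sum>n. norm (x n) * norm (y n))"
    and "tensor_series (\<lambda>n. c *\<^sub>C x n) y = (\<lambda>B. c * tensor_series x y B)"
proof -
  show "summable (\<lambda>n. norm (c *\<^sub>C x n) * norm (y n))"
    using summable_mult[OF assms, of "cmod c"] by (simp add: norm_scaleC mult.assoc)
  show "(\<Sum>n. norm (c *\<^sub>C x n) * norm (y n)) = cmod c * (\<Sum>n. norm (x n) * norm (y n))"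
    using suminf_mult[OF assms, of "cmod c"] by (simp add: norm_scaleC mult.assoc)
  have "tensor_series (\<lambda>n. c *\<^sub>C x n) y B = c * tensor_series x y B" for B
  proof (cases "bounded_cbilinear B")
    case True
    then show ?thesis
      using suminf_mult[OF summable_norm_cancel[OF summable_bilinear[OF True assms]], of c]
      by (simp add: tensor_series_def) (simp add: bounded_cbilinear_def)
  qed (simp add: tensor_series_def)
  then show "tensor_series (\<lambda>n. c *\<^sub>C x n) y = (\<lambda>B. c * tensor_series x y B)" by blast
qed

instantiation ptensor :: (complex_normed_vector, complex_normed_vector) complex_normed_vector
begin

definition norm_ptensor :: "('a, 'b) ptensor \<Rightarrow> real"
  where "norm_ptensor u = Inf {(\<Sum>n. norm (x n) * norm (y n)) | x y. ptensor_rep u x y}"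

lift_definition zero_ptensor :: "('a, 'b) ptensor" is "\<lambda>_. 0"
proof -
  have "(\<lambda>_. 0) = tensor_series (\<lambda>_. 0 :: 'a) (\<lambda>_. 0 :: 'b)"
    by (auto simp: tensor_series_def bounded_cbilinear_def bounded_bilinear.zero_left)
  then show "\<exists>x y. summable (\<lambda>n. norm (x n :: 'a) * norm (y n :: 'b)) \<and> (\<lambda>_. 0) = tensor_series x y"
    by (intro exI[of _ "\<lambda>_. 0"]) auto
qed

lift_definition plus_ptensor :: "('a, 'b) ptensor \<Rightarrow> ('a, 'b) ptensor \<Rightarrow> ('a, 'b) ptensor"
  is "\<lambda>u v B. u B + v B"
proof -
  fix u v :: "('a \<Rightarrow> 'b \<Rightarrow> complex) \<Rightarrow> complex"
  assume "\<exists>x y. summable (\<lambda>n. norm (x n) * norm (y n)) \<and> u = tensor_series x y"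
    "\<exists>x y. summable (\<lambda>n. norm (x n) * norm (y n)) \<and> v = tensor_series x y"
  then obtain x y x' y' where
    xy: "summable (\<lambda>n. norm (x n) * norm (y n))" "u = tensor_series x y" and
    xy': "summable (\<lambda>n. norm (x' n) * norm (y' n))" "v = tensor_series x' y'"
    by blast
  obtain z w where "(\<lambda>n. norm (z n) * norm (w n)) sums
      ((\<Sum>n. norm (x n) * norm (y n)) + (\<Sum>n. norm (x' n) * norm (y' n)))"
    "tensor_series z w = (\<lambda>B. tensor_series x y B + tensor_series x' y' B)"
    by (rule tensor_series_add[OF xy(1) xy'(1)])
  with xy(2) xy'(2) show "\<exists>x y. summable (\<lambda>n. norm (x n) * norm (y n)) \<and>
      (\<lambda>B. u B + v B) = tensor_series x y"
    by (intro exI[of _ z] exI[of _ w]) (simp add: sums_summable)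
qed

lift_definition scaleC_ptensor :: "complex \<Rightarrow> ('a, 'b) ptensor \<Rightarrow> ('a, 'b) ptensor"
  is "\<lambda>c u B. c * u B"
proof -
  fix c :: complex and u :: "('a \<Rightarrow> 'b \<Rightarrow> complex) \<Rightarrow> complex"
  assume "\<exists>x y. summable (\<lambda>n. norm (x n) * norm (y n)) \<and> u = tensor_series x y"
  then obtain x y where xy: "summable (\<lambda>n. norm (x n) * norm (y n))" "u = tensor_series x y"
    by blast
  from tensor_series_scaleC(1,3)[OF xy(1), of c] xy(2)
  show "\<exists>x y. summable (\<lambda>n. norm (x n) * norm (y n)) \<and> (\<lambda>B. c * u B) = tensor_series x y"
    by (intro exI[of _ "\<lambda>n. c *\<^sub>C x n"] exI[of _ y]) simp
qed

definition scaleR_ptensor :: "real \<Rightarrow> ('a, 'b) ptensor \<Rightarrow> ('a, 'b) ptensor"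
  where "scaleR_ptensor r u = complex_of_real r *\<^sub>C u"

definition uminus_ptensor :: "('a, 'b) ptensor \<Rightarrow> ('a, 'b) ptensor"
  where "uminus_ptensor u = (- 1) *\<^sub>C u"

definition minus_ptensor :: "('a, 'b) ptensor \<Rightarrow> ('a, 'b) ptensor \<Rightarrow> ('a, 'b) ptensor"
  where "minus_ptensor u v = u + - v"

definition dist_ptensor :: "('a, 'b) ptensor \<Rightarrow> ('a, 'b) ptensor \<Rightarrow> real"
  where "dist_ptensor u v = norm (u - v)"

definition uniformity_ptensor :: "(('a, 'b) ptensor \<times> ('a, 'b) ptensor) filter"
  where "uniformity_ptensor = (INF e\<in>{0 <..}. principal {(x, y). dist x y < e})"

definition open_ptensor :: "('a, 'b) ptensor set \<Rightarrow> bool"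
  where "open_ptensor S = (\<forall>x\<in>S. \<forall>\<^sub>F (x', y) in uniformity. x' = x \<longrightarrow> y \<in> S)"

definition sgn_ptensor :: "('a, 'b) ptensor \<Rightarrow> ('a, 'b) ptensor"
  where "sgn_ptensor x = scaleR (inverse (norm x)) x"

lemma ptensor_rep_exists: "\<exists>x y. ptensor_rep (u :: ('a, 'b) ptensor) x y"
  using ptensor_apply[of u] by (auto simp: ptensor_rep_def)

lemma ptensor_rep_nonneg: "ptensor_rep u x y \<Longrightarrow> 0 \<le> (\<Sum>n. norm (x n) * norm (y n))"
  by (auto simp: ptensor_rep_def intro!: suminf_nonneg)

lemma norm_ptensor_le_rep:
  "ptensor_rep u x y \<Longrightarrow> norm (u :: ('a, 'b) ptensor) \<le> (\<Sum>n. norm (x n) * norm (y n))"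
  unfolding norm_ptensor_def
  by (rule cInf_lower) (auto intro!: bdd_belowI[of _ 0] ptensor_rep_nonneg)

lemma norm_ptensor_less_rep:
  assumes "norm (u :: ('a, 'b) ptensor) < r"
  obtains x y where "ptensor_rep u x y" "(\<Sum>n. norm (x n) * norm (y n)) < r"
proof -
  have "{(\<Sum>n. norm (x n) * norm (y n)) | x y. ptensor_rep u x y} \<noteq> {}"
    using ptensor_rep_exists[of u] by blast
  from cInf_lessD[OF this] assms show ?thesis
    unfolding norm_ptensor_def using that by blast
qed

lemma norm_ptensor_greatest:
  assumes "\<And>x y. ptensor_rep u x y \<Longrightarrow> z \<le> K * (\<Sum>n. norm (x n) * norm (y n))" "0 \<le> K"
  shows "z \<le> K * norm (u :: ('a, 'b) ptensor)"
proof (rule field_le_epsilon)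
  fix e :: real assume e: "0 < e"
  have "norm u < norm u + e / (K + 1)" using e assms(2) by simp
  then obtain x y where xy: "ptensor_rep u x y" "(\<Sum>n. norm (x n) * norm (y n)) < norm u + e / (K + 1)"
    using norm_ptensor_less_rep by blast
  have "z \<le> K * (norm u + e / (K + 1))"
    using assms(1)[OF xy(1)] mult_left_mono[OF less_imp_le[OF xy(2)] assms(2)] by linarith
  also have "\<dots> \<le> K * norm u + e"
    using e assms(2) by (simp add: field_simps)
  finally show "z \<le> K * norm u + e" .
qed

lemma ptensor_apply_bound:
  assumes "bounded_cbilinear B" "0 \<le> K" "\<And>x y. cmod (B x y) \<le> norm x * norm y * K"
  shows "cmod (ptensor_apply (u :: ('a, 'b) ptensor) B) \<le> K * norm u"
proof (rule norm_ptensor_greatest)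
  fix x y assume "ptensor_rep u x y"
  then have xy: "summable (\<lambda>n. norm (x n) * norm (y n))" "ptensor_apply u B = (\<Sum>n. B (x n) (y n))"
    using assms(1) by (auto simp: ptensor_rep_def tensor_series_def)
  have "cmod (\<Sum>n. B (x n) (y n)) \<le> (\<Sum>n. cmod (B (x n) (y n)))"
    by (rule summable_norm[OF summable_bilinear[OF assms(1) xy(1)]])
  also have "\<dots> \<le> (\<Sum>n. norm (x n) * norm (y n) * K)"
    by (rule suminf_le[OF _ summable_bilinear[OF assms(1) xy(1)] summable_mult2[OF xy(1)]])
      (use assms(3) in auto)
  also have "\<dots> = K * (\<Sum>n. norm (x n) * norm (y n))"
    using suminf_mult[OF xy(1), of K] by (simp add: mult.commute)
  finally show "cmod (ptensor_apply u B) \<le> K * (\<Sum>n. norm (x n) * norm (y n))"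
    by (simp add: xy(2))
qed (rule assms(2))

lemma norm_scaleC_ptensor_le: "norm (c *\<^sub>C u) \<le> cmod c * norm (u :: ('a, 'b) ptensor)"
proof (rule norm_ptensor_greatest)
  fix x y assume "ptensor_rep u x y"
  then have xy: "summable (\<lambda>n. norm (x n) * norm (y n))" "ptensor_apply u = tensor_series x y"
    by (auto simp: ptensor_rep_def)
  have "ptensor_rep (c *\<^sub>C u) (\<lambda>n. c *\<^sub>C x n) y"
    unfolding ptensor_rep_def scaleC_ptensor.rep_eq using tensor_series_scaleC[OF xy(1)] xy(2) by simp
  from norm_ptensor_le_rep[OF this]
  show "norm (c *\<^sub>C u) \<le> cmod c * (\<Sum>n. norm (x n) * norm (y n))"
    using tensor_series_scaleC(2)[OF xy(1)] by simp
qed simp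

instance
proof
  fix f g h :: "('a, 'b) ptensor" and c d :: complex and r s :: real
  show "f + g + h = f + (g + h)" "f + g = g + f" "0 + f = f"
    by (transfer; simp add: fun_eq_iff)+
  show "- f + f = 0" unfolding uminus_ptensor_def by transfer (simp add: fun_eq_iff)
  show "f - g = f + - g" by (rule minus_ptensor_def)
  show "c *\<^sub>C (f + g) = c *\<^sub>C f + c *\<^sub>C g" "(c + d) *\<^sub>C f = c *\<^sub>C f + d *\<^sub>C f"
    "c *\<^sub>C d *\<^sub>C f = (c * d) *\<^sub>C f"
    by (transfer; simp add: fun_eq_iff algebra_simps)+
  show "r *\<^sub>R f = complex_of_real r *\<^sub>C f" by (rule scaleR_ptensor_def)
  show "r *\<^sub>R (f + g) = r *\<^sub>R f + r *\<^sub>R g" "(r + s) *\<^sub>R f = r *\<^sub>R f + s *\<^sub>R f"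
    "r *\<^sub>R s *\<^sub>R f = (r * s) *\<^sub>R f" "1 *\<^sub>R f = f"
    unfolding scaleR_ptensor_def by (transfer; simp add: fun_eq_iff algebra_simps)+
  show "dist f g = norm (f - g)" by (rule dist_ptensor_def)
  show "(uniformity :: (('a, 'b) ptensor \<times> ('a, 'b) ptensor) filter) =
      (INF e\<in>{0 <..}. principal {(x, y). dist x y < e})"
    by (rule uniformity_ptensor_def)
  show "open U = (\<forall>x\<in>U. \<forall>\<^sub>F (x', y) in uniformity. x' = x \<longrightarrow> y \<in> U)"
    for U :: "('a, 'b) ptensor set"
    by (rule open_ptensor_def)
  show "sgn f = inverse (norm f) *\<^sub>R f" by (rule sgn_ptensor_def)
  have nonneg: "0 \<le> norm f" for f :: "('a, 'b) ptensor"
    using norm_ptensor_greatest[of f 0 1] by (simp add: ptensor_rep_nonneg)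
  show "(norm f = 0) = (f = 0)"
  proof
    assume 0: "norm f = 0"
    show "f = 0"
    proof (rule ptensor_eqI)
      fix B :: "'a \<Rightarrow> 'b \<Rightarrow> complex" assume B: "bounded_cbilinear B"
      obtain K where K: "0 \<le> K" "\<And>x y. norm (B x y) \<le> norm x * norm y * K"
        using bounded_cbilinear_bound[OF B] by blast
      show "ptensor_apply f B = ptensor_apply 0 B"
        using ptensor_apply_bound[OF B K, of f] 0 by (simp add: zero_ptensor.rep_eq)
    qed
  next
    assume "f = 0"
    then have "f = 0 *\<^sub>C f" by transfer auto
    then show "norm f = 0"
      using norm_scaleC_ptensor_le[of 0 f] nonneg[of f] by simp
  qed
  show "norm (f + g) \<le> norm f + norm g"
  proof (rule field_le_epsilon)
    fix e :: real assume e: "0 < e"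
    obtain x y where xy: "ptensor_rep f x y" "(\<Sum>n. norm (x n) * norm (y n)) < norm f + e / 2"
      using norm_ptensor_less_rep[of f "norm f + e / 2"] e by auto
    obtain x' y' where xy': "ptensor_rep g x' y'" "(\<Sum>n. norm (x' n) * norm (y' n)) < norm g + e / 2"
      using norm_ptensor_less_rep[of g "norm g + e / 2"] e by auto
    obtain z w where zw: "(\<lambda>n. norm (z n) * norm (w n)) sums
        ((\<Sum>n. norm (x n) * norm (y n)) + (\<Sum>n. norm (x' n) * norm (y' n)))"
      "tensor_series z w = (\<lambda>B. tensor_series x y B + tensor_series x' y' B)"
      using tensor_series_add[of x y x' y'] xy(1) xy'(1) by (auto simp: ptensor_rep_def)
    have "ptensor_rep (f + g) z w"
      using zw xy(1) xy'(1) by (auto simp: ptensor_rep_def plus_ptensor.rep_eq sums_iff)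
    from norm_ptensor_le_rep[OF this] show "norm (f + g) \<le> norm f + norm g + e"
      using zw(1) xy(2) xy'(2) by (auto simp: sums_iff)
  qed
  show *: "norm (c *\<^sub>C f) = cmod c * norm f" for c and f :: "('a, 'b) ptensor"
  proof (rule antisym)
    show "cmod c * norm f \<le> norm (c *\<^sub>C f)"
    proof (cases "c = 0")
      case False
      have "f = inverse c *\<^sub>C (c *\<^sub>C f)"
        using False by transfer (auto simp: fun_eq_iff)
      then have "norm f \<le> cmod (inverse c) * norm (c *\<^sub>C f)"
        by (metis norm_scaleC_ptensor_le)
      then have "cmod c * norm f \<le> cmod c * (cmod (inverse c) * norm (c *\<^sub>C f))"
        by (rule mult_left_mono) simp
      then show ?thesis using False by (simp add: norm_inverse mult.assoc[symmetric])
    qed (simp add: nonneg)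
  qed (rule norm_scaleC_ptensor_le)
  show "norm (r *\<^sub>R f) = \<bar>r\<bar> * norm f"
    unfolding scaleR_ptensor_def by (simp add: *)
qed

end

lemma ptensor_apply_add: "ptensor_apply (u + v) B = ptensor_apply u B + ptensor_apply v B"
  and ptensor_apply_scaleC: "ptensor_apply (c *\<^sub>C u) B = c * ptensor_apply u B"
  by (transfer; simp)+

lemma ptensor_apply_diff: "ptensor_apply (u - v) B = ptensor_apply u B - ptensor_apply v B"
  unfolding minus_ptensor_def uminus_ptensor_def by transfer simp

lemma ptensor_apply_sum: "ptensor_apply (sum U A) B = (\<Sum>k\<in>A. ptensor_apply (U k) B)"
  by (induction A rule: infinite_finite_induct) (auto simp: ptensor_apply_add zero_ptensor.rep_eq)

lemma ptensor_series:
  fixes U :: "nat \<Rightarrow> ('a::complex_normed_vector, 'b::complex_normed_vector) ptensor"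
  assumes U: "\<And>k. norm (U k) < c k" and c: "summable c"
  obtains V where "norm V \<le> suminf c"
    "\<And>B. bounded_cbilinear B \<Longrightarrow> (\<lambda>k. ptensor_apply (U k) B) sums ptensor_apply V B"
proof -
  have "\<forall>k. \<exists>x y. ptensor_rep (U k) x y \<and> (\<Sum>n. norm (x n) * norm (y n)) < c k"
    using norm_ptensor_less_rep[OF U] by metis
  then obtain X Y where XY: "\<And>k. ptensor_rep (U k) (X k) (Y k)"
      "\<And>k. (\<Sum>n. norm (X k n) * norm (Y k n)) < c k"
    by metis
  have s: "summable (\<lambda>k. \<Sum>n. norm (X k n) * norm (Y k n))"
  proof (rule summable_comparison_test'[OF c, of 0])
    show "norm (\<Sum>n. norm (X k n) * norm (Y k n)) \<le> c k" for k
      using XY(2)[of k] ptensor_rep_nonneg[OF XY(1)[of k]] by simp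
  qed
  obtain x y where xy: "(\<lambda>n. norm (x n) * norm (y n)) sums (\<Sum>k. \<Sum>n. norm (X k n) * norm (Y k n))"
      "\<And>B. bounded_cbilinear B \<Longrightarrow> (\<lambda>k. tensor_series (X k) (Y k) B) sums tensor_series x y B"
    by (rule tensor_series_double[OF _ s]) (use XY(1) in \<open>auto simp: ptensor_rep_def\<close>)
  define V where "V = Ptensor (tensor_series x y)"
  have V: "ptensor_rep V x y"
    unfolding ptensor_rep_def V_def using Ptensor_inverse[of "tensor_series x y"] xy(1)
    by (auto simp: sums_iff)
  show ?thesis
  proof
    have "norm V \<le> (\<Sum>k. \<Sum>n. norm (X k n) * norm (Y k n))"
      using norm_ptensor_le_rep[OF V] xy(1) by (simp add: sums_iff)
    also have "\<dots> \<le> suminf c"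
      by (rule suminf_le[OF _ s c]) (simp add: XY(2) less_imp_le)
    finally show "norm V \<le> suminf c" .
    show "(\<lambda>k. ptensor_apply (U k) B) sums ptensor_apply V B" if "bounded_cbilinear B" for B
      using xy(2)[OF that] XY(1) V by (simp add: ptensor_rep_def)
  qed
qed

lemma ptensor_summable:
  fixes U :: "nat \<Rightarrow> ('a::complex_normed_vector, 'b::complex_normed_vector) ptensor"
  assumes U: "\<And>k. norm (U k) < c k" and c: "summable c"
    and V: "\<And>B. bounded_cbilinear B \<Longrightarrow> (\<lambda>k. ptensor_apply (U k) B) sums ptensor_apply V B"
  shows "U sums V"
proof -
  have le: "norm ((\<Sum>k<n. U k) - V) \<le> (\<Sum>k. c (k + n))" for n
  proof -
    have U': "norm (U (k + n)) < c (k + n)" for k by (rule U)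
    have c': "summable (\<lambda>k. c (k + n))" using c by (rule summable_ignore_initial_segment)
    obtain W where W: "norm W \<le> (\<Sum>k. c (k + n))"
        "\<And>B. bounded_cbilinear B \<Longrightarrow> (\<lambda>k. ptensor_apply (U (k + n)) B) sums ptensor_apply W B"
      by (rule ptensor_series[of "\<lambda>k. U (k + n)" "\<lambda>k. c (k + n)", OF U' c'], rule that, assumption, blast)
    have "W = V - (\<Sum>k<n. U k)"
    proof (rule ptensor_eqI)
      fix B :: "'a \<Rightarrow> 'b \<Rightarrow> complex" assume B: "bounded_cbilinear B"
      show "ptensor_apply W B = ptensor_apply (V - (\<Sum>k<n. U k)) B"
        using sums_unique2[OF W(2)[OF B] sums_split_initial_segment[OF V[OF B], of n]]
        by (simp add: ptensor_apply_diff ptensor_apply_sum)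
    qed
    with W(1) show ?thesis by (simp add: norm_minus_commute)
  qed
  have "(\<lambda>n. (\<Sum>k<n. U k) - V) \<longlonglongrightarrow> 0"
    by (rule Lim_null_comparison[OF always_eventually suminf_exist_split2[OF c]]) (use le in blast)
  then show ?thesis unfolding sums_def by (rule LIM_zero_cancel)
qed

instance ptensor :: (complex_normed_vector, complex_normed_vector) complex_banach
proof
  fix X :: "nat \<Rightarrow> ('a, 'b) ptensor" assume X: "Cauchy X"
  have "\<forall>k. \<exists>N. \<forall>m\<ge>N. \<forall>n\<ge>N. norm (X m - X n) < (1/2) ^ k"
    using CauchyD[OF X, of "(1/2) ^ _"] by simp
  then obtain N where N: "\<And>k m n. m \<ge> N k \<Longrightarrow> n \<ge> N k \<Longrightarrow> norm (X m - X n) < (1/2) ^ k"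
    by metis
  define M where "M = (\<lambda>k. \<Sum>i\<le>k. N i)"
  have M: "N k \<le> M k" "N k \<le> M (Suc k)" for k
    unfolding M_def by (auto intro!: member_le_sum trans_le_add1)
  define U where "U = (\<lambda>k. X (M (Suc k)) - X (M k))"
  have U: "norm (U k) < (1/2) ^ k" for k
    unfolding U_def using N[OF M(2) M(1)] .
  have c: "summable (\<lambda>k. (1/2 :: real) ^ k)" by (rule summable_geometric) simp
  obtain V where V: "\<And>B. bounded_cbilinear B \<Longrightarrow>
      (\<lambda>k. ptensor_apply (U k) B) sums ptensor_apply V B"
    by (rule ptensor_series[OF U c], rule that, blast)
  have "U sums V" by (rule ptensor_summable[OF U c V])
  moreover have "(\<Sum>k<n. U k) = X (M n) - X (M 0)" for n
    unfolding U_def by (rule sum_lessThan_telescope)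
  ultimately have "(\<lambda>n. X (M n) - X (M 0)) \<longlonglongrightarrow> V"
    by (simp add: sums_def)
  from tendsto_add[OF this tendsto_const[of "X (M 0)"]]
  have L: "(\<lambda>n. X (M n)) \<longlonglongrightarrow> V + X (M 0)" by simp
  have "X \<longlonglongrightarrow> V + X (M 0)"
  proof (rule LIMSEQ_I)
    fix r :: real assume r: "0 < r"
    obtain n0 where n0: "\<And>n. n \<ge> n0 \<Longrightarrow> norm (X (M n) - (V + X (M 0))) < r / 2"
      using LIMSEQ_D[OF L, of "r/2"] r by auto
    obtain n1 where n1: "(1/2 :: real) ^ n1 < r / 2"
      using real_arch_pow_inv[of "r/2" "1/2"] r by auto
    define n where "n = max n0 n1"
    have "(1/2 :: real) ^ n \<le> (1/2) ^ n1"
      unfolding n_def by (rule power_decreasing) auto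
    then have n: "norm (X (M n) - (V + X (M 0))) < r / 2" "(1/2 :: real) ^ n < r / 2"
      using n0[of n] n1 unfolding n_def by (simp, linarith)
    have "norm (X m - (V + X (M 0))) < r" if "m \<ge> N n" for m
      using N[OF that M(1)] n norm_diff_triangle_less[of "X m" "X (M n)" "r/2" "V + X (M 0)" "r/2"]
      by simp
    then show "\<exists>no. \<forall>m\<ge>no. norm (X m - (V + X (M 0))) < r" by blast
  qed
  then show "convergent X" by (auto simp: convergent_def)
qed

definition tensor :: "'a::complex_normed_vector \<Rightarrow> 'b::complex_normed_vector \<Rightarrow> ('a, 'b) ptensor"
    (infixl \<open>\<otimes>\<^sub>p\<close> 70)
  where "a \<otimes>\<^sub>p b = Ptensor (\<lambda>B. if bounded_cbilinear B then B a b else 0)"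

lemma ptensor_rep_tensor:
  "ptensor_rep (a \<otimes>\<^sub>p b) (\<lambda>n. if n = 0 then a else 0) (\<lambda>n. if n = 0 then b else 0)"
proof -
  let ?x = "\<lambda>n::nat. if n = 0 then a else 0" and ?y = "\<lambda>n::nat. if n = 0 then b else 0"
  have s: "summable (\<lambda>n. norm (?x n) * norm (?y n))"
    by (rule summable_finite[of "{0}"]) auto
  have "(\<lambda>B. if bounded_cbilinear B then B a b else 0) = tensor_series ?x ?y"
  proof
    fix B :: "'a \<Rightarrow> 'b \<Rightarrow> complex"
    show "(if bounded_cbilinear B then B a b else 0) = tensor_series ?x ?y B"
    proof (cases "bounded_cbilinear B")
      case True
      then have "B 0 0 = 0" by (auto simp: bounded_cbilinear_def bounded_bilinear.zero_left)
      then have "(\<Sum>n. B (?x n) (?y n)) = (\<Sum>n\<in>{0}. B (?x n) (?y n))"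
        by (intro suminf_finite) auto
      with True show ?thesis by (simp add: tensor_series_def)
    qed (simp add: tensor_series_def)
  qed
  with s show ?thesis
    unfolding ptensor_rep_def tensor_def by (auto intro!: Ptensor_inverse)
qed

lemma ptensor_apply_tensor: "bounded_cbilinear B \<Longrightarrow> ptensor_apply (a \<otimes>\<^sub>p b) B = B a b"
proof -
  assume B: "bounded_cbilinear B"
  then have "B 0 0 = 0" by (auto simp: bounded_cbilinear_def bounded_bilinear.zero_left)
  then have "(\<Sum>n. B (if n = 0 then a else 0) (if n = (0::nat) then b else 0)) =
      (\<Sum>n\<in>{0::nat}. B (if n = 0 then a else 0) (if n = 0 then b else 0))"
    by (intro suminf_finite) auto
  then show ?thesis
    using ptensor_rep_tensor[of a b] B by (simp add: ptensor_rep_def tensor_series_def)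
qed

lemma norm_tensor_le: "norm (a \<otimes>\<^sub>p b) \<le> norm a * norm b"
proof -
  have "(\<Sum>n. norm (if n = 0 then a else 0) * norm (if n = (0::nat) then b else 0)) =
      (\<Sum>n\<in>{0::nat}. norm (if n = 0 then a else 0) * norm (if n = 0 then b else 0))"
    by (intro suminf_finite) auto
  then show ?thesis using norm_ptensor_le_rep[OF ptensor_rep_tensor[of a b]] by simp
qed

lemma bounded_cbilinear_tensor: "bounded_cbilinear (\<otimes>\<^sub>p)"
proof (rule bounded_cbilinearI)
  show "norm (x \<otimes>\<^sub>p y) \<le> norm x * norm y * 1" for x :: 'a and y :: 'b
    using norm_tensor_le[of x y] by simp
qed (auto intro!: ptensor_eqI simp: ptensor_apply_tensor ptensor_apply_add ptensor_apply_scaleC,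
    auto simp: bounded_cbilinear_def bounded_bilinear.add_left bounded_bilinear.add_right)

lemma tensor_simps:
  "(x + y) \<otimes>\<^sub>p z = x \<otimes>\<^sub>p z + y \<otimes>\<^sub>p z" "x \<otimes>\<^sub>p (z + w) = x \<otimes>\<^sub>p z + x \<otimes>\<^sub>p w"
  "(c *\<^sub>C x) \<otimes>\<^sub>p z = c *\<^sub>C (x \<otimes>\<^sub>p z)" "x \<otimes>\<^sub>p (c *\<^sub>C z) = c *\<^sub>C (x \<otimes>\<^sub>p z)"
proof -
  have "bounded_bilinear ((\<otimes>\<^sub>p) :: 'a \<Rightarrow> 'b \<Rightarrow> _)"
    using bounded_cbilinear_tensor by (auto simp: bounded_cbilinear_def)
  then show "(x + y) \<otimes>\<^sub>p z = x \<otimes>\<^sub>p z + y \<otimes>\<^sub>p z" "x \<otimes>\<^sub>p (z + w) = x \<otimes>\<^sub>p z + x \<otimes>\<^sub>p w"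
    by (rule bounded_bilinear.add_left, rule bounded_bilinear.add_right)
qed (use bounded_cbilinear_tensor in \<open>auto simp: bounded_cbilinear_def\<close>)

lemma ptensor_rep_sums:
  assumes "ptensor_rep u x y"
  shows "(\<lambda>n. x n \<otimes>\<^sub>p y n) sums u"
proof (rule ptensor_summable)
  have s: "summable (\<lambda>n. norm (x n) * norm (y n))" using assms by (simp add: ptensor_rep_def)
  show "norm (x n \<otimes>\<^sub>p y n) < norm (x n) * norm (y n) + (1/2) ^ n" for n
    using norm_tensor_le[of "x n" "y n"] zero_less_power[of "1/2::real" n] by linarith
  show "summable (\<lambda>n. norm (x n) * norm (y n) + (1/2) ^ n)"
    by (intro summable_add s summable_geometric) simp
  show "(\<lambda>n. ptensor_apply (x n \<otimes>\<^sub>p y n) B) sums ptensor_apply u B" if "bounded_cbilinear B" for B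
    using summable_sums[OF summable_norm_cancel[OF summable_bilinear[OF that s]]] assms that
    by (simp add: ptensor_apply_tensor ptensor_rep_def tensor_series_def)
qed

lemma ptensor_map_sums:
  assumes "bounded_clinear T" "ptensor_rep u x y"
  shows "(\<lambda>n. T (x n \<otimes>\<^sub>p y n)) sums T u"
  using assms(1) bounded_linear.sums[OF _ ptensor_rep_sums[OF assms(2)], of T]
  unfolding bounded_clinear_def by simp

lemma ptensor_map_eqI:
  fixes S T :: "('a::complex_normed_vector, 'b::complex_normed_vector) ptensor \<Rightarrow> 'c::complex_normed_vector"
  assumes "bounded_clinear S" "bounded_clinear T" "\<And>a b. S (a \<otimes>\<^sub>p b) = T (a \<otimes>\<^sub>p b)"
  shows "S = T"
proof
  fix u :: "('a, 'b) ptensor"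
  obtain x y where "ptensor_rep u x y" using ptensor_rep_exists by blast
  then show "S u = T u"
    using ptensor_map_sums[OF assms(1), of u x y] ptensor_map_sums[OF assms(2), of u x y]
    by (simp add: assms(3) sums_unique2)
qed

lemma ptensor_map_bound:
  assumes "bounded_clinear T" "0 \<le> K" "\<And>a b. norm (T (a \<otimes>\<^sub>p b)) \<le> K * (norm a * norm b)"
  shows "norm (T u) \<le> K * norm u"
proof (rule norm_ptensor_greatest)
  fix x y assume xy: "ptensor_rep u x y"
  then have s: "summable (\<lambda>n. K * (norm (x n) * norm (y n)))"
    by (auto simp: ptensor_rep_def intro: summable_mult)
  have s': "summable (\<lambda>n. norm (T (x n \<otimes>\<^sub>p y n)))"
    by (rule summable_comparison_test'[OF s]) (use assms(3) in auto)
  have "norm (T u) \<le> (\<Sum>n. norm (T (x n \<otimes>\<^sub>p y n)))"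
  proof (rule LIMSEQ_le_const2)
    show "(\<lambda>m. norm (\<Sum>n<m. T (x n \<otimes>\<^sub>p y n))) \<longlonglongrightarrow> norm (T u)"
      using ptensor_map_sums[OF assms(1) xy] unfolding sums_def by (rule tendsto_norm)
    have "norm (\<Sum>n<m. T (x n \<otimes>\<^sub>p y n)) \<le> (\<Sum>n. norm (T (x n \<otimes>\<^sub>p y n)))" for m
      using sum_le_suminf[OF s', of "{..<m}"] by (auto intro: order_trans[OF norm_sum])
    then show "\<exists>N. \<forall>m\<ge>N. norm (\<Sum>n<m. T (x n \<otimes>\<^sub>p y n)) \<le> (\<Sum>n. norm (T (x n \<otimes>\<^sub>p y n)))"
      by blast
  qed
  also have "\<dots> \<le> (\<Sum>n. K * (norm (x n) * norm (y n)))"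
    by (rule suminf_le[OF _ s' s]) (rule assms(3))
  also have "\<dots> = K * (\<Sum>n. norm (x n) * norm (y n))"
    using xy by (intro suminf_mult) (auto simp: ptensor_rep_def)
  finally show "norm (T u) \<le> K * (\<Sum>n. norm (x n) * norm (y n))" .
qed (rule assms(2))

text \<open>The linearization of a bounded bilinear map. The hypothesis on \<open>'c\<close> in the lemma below
  holds in every normed space by the Hahn-Banach theorem; for the spaces used here it is
  available directly.\<close>

definition ptensor_lift ::
    "('a::complex_normed_vector \<Rightarrow> 'b::complex_normed_vector \<Rightarrow> 'c::complex_normed_vector) \<Rightarrow>
     ('a, 'b) ptensor \<Rightarrow> 'c"
  where "ptensor_lift B = (THE T. bounded_clinear T \<and> (\<forall>a b. T (a \<otimes>\<^sub>p b) = B a b))"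

lemma bounded_cbilinear_cdual_apply:
  assumes "bounded_cbilinear B"
  shows "bounded_cbilinear (\<lambda>x y. cdual_apply f (B x y))"
proof -
  obtain K where K: "0 \<le> K" "\<And>x y. norm (B x y) \<le> norm x * norm y * K"
    using bounded_cbilinear_bound[OF assms] by blast
  show ?thesis
  proof (rule bounded_cbilinearI)
    show "cmod (cdual_apply f (B x y)) \<le> norm x * norm y * (K * norm f)" for x y
      using cdual_apply_bound[of f "B x y"] mult_right_mono[OF K(2)[of x y] norm_ge_zero[of f]]
      by (simp add: mult_ac)
  qed (use assms in \<open>auto simp: bounded_cbilinear_def bounded_bilinear.add_left
      bounded_bilinear.add_right cdual_apply_add cdual_apply_scaleC\<close>)
qed

lemma
  fixes B :: "'a::complex_normed_vector \<Rightarrow> 'b::complex_normed_vector \<Rightarrow> 'c::complex_banach"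
  assumes B: "bounded_cbilinear B"
    and sep: "\<And>z w :: 'c. (\<And>f. cdual_apply f z = cdual_apply f w) \<Longrightarrow> z = w"
  shows bounded_clinear_ptensor_lift: "bounded_clinear (ptensor_lift B)"
    and ptensor_lift_tensor: "ptensor_lift B (a \<otimes>\<^sub>p b) = B a b"
proof -
  obtain K where K: "0 \<le> K" "\<And>x y. norm (B x y) \<le> norm x * norm y * K"
    using bounded_cbilinear_bound[OF B] by blast
  have s: "summable (\<lambda>n. norm (B (x n) (y n)))" "summable (\<lambda>n. norm (x n) * norm (y n))"
    if "ptensor_rep u x y" for u x y
    using that summable_bilinear[OF B] by (auto simp: ptensor_rep_def)
  have f: "cdual_apply f (\<Sum>n. B (x n) (y n)) = ptensor_apply u (\<lambda>x y. cdual_apply f (B x y))"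
    if "ptensor_rep u x y" for u x y f
  proof -
    have "cdual_apply f (\<Sum>n. B (x n) (y n)) = (\<Sum>n. cdual_apply f (B (x n) (y n)))"
      using bounded_linear.suminf[of "cdual_apply f", OF _ summable_norm_cancel[OF s(1)[OF that]]]
        bounded_clinear_cdual_apply[of f]
      by (simp add: bounded_clinear_def)
    also have "\<dots> = ptensor_apply u (\<lambda>x y. cdual_apply f (B x y))"
      using that bounded_cbilinear_cdual_apply[OF B, of f]
      by (simp add: ptensor_rep_def tensor_series_def)
    finally show ?thesis .
  qed
  have "\<forall>u. \<exists>z. \<forall>x y. ptensor_rep u x y \<longrightarrow> z = (\<Sum>n. B (x n) (y n))"
  proof
    fix u :: "('a, 'b) ptensor"
    obtain x y where xy: "ptensor_rep u x y" using ptensor_rep_exists by blast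
    have "(\<Sum>n. B (x n) (y n)) = (\<Sum>n. B (x' n) (y' n))" if "ptensor_rep u x' y'" for x' y'
      by (rule sep) (simp add: f[OF xy] f[OF that])
    then show "\<exists>z. \<forall>x y. ptensor_rep u x y \<longrightarrow> z = (\<Sum>n. B (x n) (y n))" by blast
  qed
  from choice[OF this] obtain T where T: "\<And>u x y. ptensor_rep u x y \<Longrightarrow> T u = (\<Sum>n. B (x n) (y n))"
    by blast
  have fT: "cdual_apply f (T u) = ptensor_apply u (\<lambda>x y. cdual_apply f (B x y))" for f u
    using ptensor_rep_exists[of u] f T by metis
  have T1: "bounded_clinear T"
  proof (rule bounded_clinearI)
    show "T (u + v) = T u + T v" for u v
      by (rule sep) (simp add: fT cdual_apply_add ptensor_apply_add)
    show "T (c *\<^sub>C u) = c *\<^sub>C T u" for c u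
      by (rule sep) (simp add: fT cdual_apply_scaleC ptensor_apply_scaleC)
    have "norm (T u) \<le> K * norm u" for u
    proof (rule norm_ptensor_greatest)
      fix x y assume xy: "ptensor_rep u x y"
      have "norm (T u) \<le> (\<Sum>n. norm (B (x n) (y n)))"
        unfolding T[OF xy] by (rule summable_norm[OF s(1)[OF xy]])
      also have "\<dots> \<le> (\<Sum>n. K * (norm (x n) * norm (y n)))"
        by (rule suminf_le[OF _ s(1)[OF xy] summable_mult[OF s(2)[OF xy]]])
          (use K(2) in \<open>simp add: mult_ac\<close>)
      also have "\<dots> = K * (\<Sum>n. norm (x n) * norm (y n))"
        by (rule suminf_mult[OF s(2)[OF xy]])
      finally show "norm (T u) \<le> K * (\<Sum>n. norm (x n) * norm (y n))" .
    qed (rule K(1))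
    then show "norm (T u) \<le> norm u * K" for u by (simp add: mult.commute)
  qed
  have T2: "T (a \<otimes>\<^sub>p b) = B a b" for a b
    by (rule sep) (simp add: fT ptensor_apply_tensor bounded_cbilinear_cdual_apply[OF B])
  have "ptensor_lift B = T"
    unfolding ptensor_lift_def
  proof (rule the_equality)
    show "S = T" if "bounded_clinear S \<and> (\<forall>a b. S (a \<otimes>\<^sub>p b) = B a b)" for S
      by (rule ptensor_map_eqI) (use that T1 T2 in auto)
  qed (use T1 T2 in blast)
  then show "bounded_clinear (ptensor_lift B)" "ptensor_lift B (a \<otimes>\<^sub>p b) = B a b"
    using T1 T2 by auto
qed

lemma bounded_clinear_ptensor_apply:
  assumes B: "bounded_cbilinear B"
  shows "bounded_clinear (\<lambda>u. ptensor_apply u B)"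
proof -
  obtain K where K: "0 \<le> K" "\<And>x y. norm (B x y) \<le> norm x * norm y * K"
    using bounded_cbilinear_bound[OF B] by blast
  show ?thesis
    by (rule bounded_clinearI[of _ K])
      (use ptensor_apply_bound[OF B K] in \<open>auto simp: ptensor_apply_add ptensor_apply_scaleC mult.commute\<close>)
qed

lemma ptensor_separated:
  assumes "\<And>f. cdual_apply f u = cdual_apply f v"
  shows "u = (v :: ('a::complex_normed_vector, 'b::complex_normed_vector) ptensor)"
proof (rule ptensor_eqI)
  fix B :: "'a \<Rightarrow> 'b \<Rightarrow> complex" assume "bounded_cbilinear B"
  then show "ptensor_apply u B = ptensor_apply v B"
    using assms[of "Cdual (\<lambda>u. ptensor_apply u B)"]
    by (simp add: cdual_apply_Cdual bounded_clinear_ptensor_apply)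
qed

definition ptensor_left ::
    "'a::complex_banach_algebra \<Rightarrow> ('a, 'a) ptensor \<Rightarrow> ('a, 'a) ptensor"
  where "ptensor_left a = ptensor_lift (\<lambda>b c. (a * b) \<otimes>\<^sub>p c)"

definition ptensor_right ::
    "('a, 'a) ptensor \<Rightarrow> 'a::complex_banach_algebra \<Rightarrow> ('a, 'a) ptensor"
  where "ptensor_right u a = ptensor_lift (\<lambda>b c. b \<otimes>\<^sub>p (c * a)) u"

definition ptensor_prod :: "('a::complex_banach_algebra, 'a) ptensor \<Rightarrow> 'a"
  where "ptensor_prod = ptensor_lift (*)"

lemma bounded_cbilinear_tensor_mult:
  fixes a :: "'a::complex_banach_algebra"
  shows "bounded_cbilinear (\<lambda>(b::'a) (c::'a). (a * b) \<otimes>\<^sub>p c)" (is ?L)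
    and "bounded_cbilinear (\<lambda>(b::'a) (c::'a). b \<otimes>\<^sub>p (c * a))" (is ?R)
proof -
  have bound: "norm ((x::'a) \<otimes>\<^sub>p (y::'a)) \<le> norm x * norm y" for x y by (rule norm_tensor_le)
  show ?L
  proof (rule bounded_cbilinearI)
    show "norm ((a * x) \<otimes>\<^sub>p y) \<le> norm x * norm y * norm a" for x y :: 'a
      using bound[of "a * x" y] mult_right_mono[OF norm_mult_ineq[of a x] norm_ge_zero[of y]]
      by (simp add: mult_ac)
  qed (simp_all add: tensor_simps distrib_left mult_scaleC_right)
  show ?R
  proof (rule bounded_cbilinearI)
    show "norm (x \<otimes>\<^sub>p (y * a)) \<le> norm x * norm y * norm a" for x y :: 'a
      using bound[of x "y * a"] mult_left_mono[OF norm_mult_ineq[of y a] norm_ge_zero[of x]]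
      by (simp add: mult_ac)
  qed (simp_all add: tensor_simps distrib_right mult_scaleC_left)
qed

lemma bounded_clinear_ptensor_left: "bounded_clinear (ptensor_left a)"
  and ptensor_left_tensor: "ptensor_left a (b \<otimes>\<^sub>p c) = (a * b) \<otimes>\<^sub>p c"
  unfolding ptensor_left_def
   apply (rule bounded_clinear_ptensor_lift[OF bounded_cbilinear_tensor_mult(1)], rule ptensor_separated, blast)
  apply (rule ptensor_lift_tensor[OF bounded_cbilinear_tensor_mult(1)], rule ptensor_separated, blast)
  done

lemma bounded_clinear_ptensor_right: "bounded_clinear (\<lambda>u. ptensor_right u a)"
  and ptensor_right_tensor: "ptensor_right (b \<otimes>\<^sub>p c) a = b \<otimes>\<^sub>p (c * a)"
  unfolding ptensor_right_def
   apply (rule bounded_clinear_ptensor_lift[OF bounded_cbilinear_tensor_mult(2)], rule ptensor_separated, blast)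
  apply (rule ptensor_lift_tensor[OF bounded_cbilinear_tensor_mult(2)], rule ptensor_separated, blast)
  done

lemma bounded_clinear_add:
  "bounded_clinear f \<Longrightarrow> bounded_clinear g \<Longrightarrow> bounded_clinear (\<lambda>x. f x + g x)"
  by (auto simp: bounded_clinear_def bounded_linear_add scaleC_add_right)

lemma bounded_clinear_scaleC:
  assumes "bounded_clinear f"
  shows "bounded_clinear (\<lambda>x. c *\<^sub>C f x)"
proof -
  obtain K where K: "0 \<le> K" "\<And>x. norm (f x) \<le> norm x * K"
    using bounded_clinear_bound[OF assms] by blast
  show ?thesis
  proof (rule bounded_clinearI)
    show "norm (c *\<^sub>C f x) \<le> norm x * (cmod c * K)" for x
      using mult_left_mono[OF K(2)[of x] norm_ge_zero[of c]] by (simp add: norm_scaleC mult_ac)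
  qed (use assms in \<open>auto simp: bounded_clinear_def linear_simps scaleC_add_right scaleC_scaleC mult.commute\<close>)
qed

lemma bounded_clinear_compose:
  "bounded_clinear f \<Longrightarrow> bounded_clinear g \<Longrightarrow> bounded_clinear (\<lambda>x. f (g x))"
  by (auto simp: bounded_clinear_def intro: bounded_linear_compose)

lemma banach_bimodule_ptensor:
  "banach_bimodule ptensor_left (ptensor_right :: _ \<Rightarrow> 'a::complex_banach_algebra \<Rightarrow> _)"
proof -
  note L = bounded_clinear_ptensor_left and R = bounded_clinear_ptensor_right
  note LR = ptensor_left_tensor ptensor_right_tensor
  note ext = ptensor_map_eqI[THEN fun_cong]
  have lin: "ptensor_left a (u + v) = ptensor_left a u + ptensor_left a v"
    "ptensor_right (u + v) a = ptensor_right u a + ptensor_right v a"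
    "ptensor_left a (c *\<^sub>C u) = c *\<^sub>C ptensor_left a u"
    "ptensor_right (c *\<^sub>C u) a = c *\<^sub>C ptensor_right u a" for a :: 'a and u v c
    using L[of a] R[of a] linear_add[of "\<lambda>u. ptensor_right u a"]
    by (auto simp: bounded_clinear_def linear_simps bounded_linear.linear)
  have L1: "ptensor_left (a + b) u = ptensor_left a u + ptensor_left b u" for a b :: 'a and u
    by (rule ext[OF L bounded_clinear_add[OF L L]]) (simp add: LR tensor_simps distrib_right)
  have R1: "ptensor_right u (a + b) = ptensor_right u a + ptensor_right u b" for a b :: 'a and u
    by (rule ext[OF R bounded_clinear_add[OF R R]]) (simp add: LR tensor_simps distrib_left)
  have L2: "ptensor_left (c *\<^sub>C a) u = c *\<^sub>C ptensor_left a u" for a :: 'a and u c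
    by (rule ext[OF L bounded_clinear_scaleC[OF L]]) (simp add: LR tensor_simps mult_scaleC_left)
  have R2: "ptensor_right u (c *\<^sub>C a) = c *\<^sub>C ptensor_right u a" for a :: 'a and u c
    by (rule ext[OF R bounded_clinear_scaleC[OF R]]) (simp add: LR tensor_simps mult_scaleC_right)
  have L3: "norm (ptensor_left a u) \<le> norm a * norm u" for a :: 'a and u
  proof (rule ptensor_map_bound[OF L])
    show "norm (ptensor_left a (b \<otimes>\<^sub>p c)) \<le> norm a * (norm b * norm c)" for b c
      using norm_tensor_le[of "a * b" c] mult_right_mono[OF norm_mult_ineq[of a b] norm_ge_zero[of c]]
      by (simp add: LR mult_ac)
  qed simp
  have R3: "norm (ptensor_right u a) \<le> norm a * norm u" for a :: 'a and u
  proof (rule ptensor_map_bound[OF R])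
    show "norm (ptensor_right (b \<otimes>\<^sub>p c) a) \<le> norm a * (norm b * norm c)" for b c
      using norm_tensor_le[of b "c * a"] mult_left_mono[OF norm_mult_ineq[of c a] norm_ge_zero[of b]]
      by (simp add: LR mult_ac)
  qed simp
  show ?thesis
  proof
    show "bounded_cbilinear (ptensor_left :: 'a \<Rightarrow> _)"
      by (rule bounded_cbilinearI[of _ 1]) (simp_all add: lin L1 L2 L3)
    show "bounded_cbilinear (ptensor_right :: _ \<Rightarrow> 'a \<Rightarrow> _)"
      by (rule bounded_cbilinearI[of _ 1]) (use R3 in \<open>simp_all add: lin R1 R2 mult.commute\<close>)
    show "ptensor_left (a * b) u = ptensor_left a (ptensor_left b u)" for a b :: 'a and u
      by (rule ext[OF L bounded_clinear_compose[OF L L]]) (simp add: LR mult.assoc)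
    show "ptensor_right u (a * b) = ptensor_right (ptensor_right u a) b" for a b :: 'a and u
      by (rule ext[OF R bounded_clinear_compose[OF R R]]) (simp add: LR mult.assoc)
    show "ptensor_left a (ptensor_right u b) = ptensor_right (ptensor_left a u) b" for a b :: 'a and u
      by (rule ext[OF bounded_clinear_compose[OF L R] bounded_clinear_compose[OF R L]])
        (simp add: LR)
  qed
qed


section \<open>Dual Banach algebras\<close>

text \<open>The canonical map from \<open>\<A>\<close> to \<open>(\<A>\<^sub>*)\<^sup>*\<close>, where \<open>\<A>\<^sub>*\<close> is a set \<open>As\<close> of functionals.\<close>

definition canonical_map ::
    "'a::complex_normed_vector cdual set \<Rightarrow> 'a \<Rightarrow> ('a cdual \<Rightarrow> complex)"
  where "canonical_map As a = (\<lambda>f\<in>As. cdual_apply f a)"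

text \<open>The identification \<open>\<A> = (\<A>\<^sub>*)\<^sup>*\<close> is one of Banach spaces up to equivalence of norms: the
  canonical map, which is always contractive, is a bijection with bounded inverse. It is not
  required to be isometric.\<close>

definition dual_banach_algebra :: "'a::complex_banach_algebra cdual set \<Rightarrow> bool"
  where "dual_banach_algebra As \<longleftrightarrow>
    csubspace As \<and> closed As \<and>
    (\<forall>a. \<forall>f\<in>As. dual_left (*) a f \<in> As \<and> dual_right (*) f a \<in> As) \<and>
    bij_betw (canonical_map As) UNIV (dual_on As) \<and>
    (\<exists>K. \<forall>a. norm a \<le> K * dual_norm_on As (canonical_map As a))"

definition of_predual_dual ::
    "'a::complex_banach_algebra cdual set \<Rightarrow> ('a cdual \<Rightarrow> complex) \<Rightarrow> 'a"
  where "of_predual_dual As = inv_into UNIV (canonical_map As)"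

lemma ptensor_prod:
  fixes As :: "'a::complex_banach_algebra cdual set"
  assumes "dual_banach_algebra As"
  shows "bounded_clinear (ptensor_prod :: ('a, 'a) ptensor \<Rightarrow> 'a)"
    and "ptensor_prod (a \<otimes>\<^sub>p b) = a * (b :: 'a)"
proof -
  have B: "bounded_cbilinear ((*) :: 'a \<Rightarrow> _)"
    using banach_bimodule_algebra by (rule banach_bimodule.bounded_left)
  have inj: "inj (canonical_map As)"
    using assms by (auto simp: dual_banach_algebra_def bij_betw_def)
  have sep: "z = w" if "\<And>f. cdual_apply f z = cdual_apply f w" for z w :: 'a
    using that by (intro injD[OF inj]) (auto simp: canonical_map_def)
  show "bounded_clinear (ptensor_prod :: ('a, 'a) ptensor \<Rightarrow> 'a)"
    unfolding ptensor_prod_def by (rule bounded_clinear_ptensor_lift[OF B sep])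
  show "ptensor_prod (a \<otimes>\<^sub>p b) = a * (b :: 'a)"
    unfolding ptensor_prod_def by (rule ptensor_lift_tensor[OF B sep])
qed

text \<open>\<open>\<sigma>wc(E)\<close>, with the wk*-topology \<open>\<sigma>(\<A>, \<A>\<^sub>*)\<close> on \<open>\<A>\<close> and the weak topology \<open>\<sigma>(E, E\<^sup>*)\<close>
  on \<open>E\<close>.\<close>

definition sigma_wc ::
    "'a::complex_banach_algebra cdual set \<Rightarrow>
     ('a \<Rightarrow> 'e \<Rightarrow> 'e) \<Rightarrow> ('e \<Rightarrow> 'a \<Rightarrow> 'e) \<Rightarrow> 'e::complex_normed_vector set"
  where "sigma_wc As l r = {x.
    continuous_map (sigma_topology As) (sigma_topology UNIV) (\<lambda>a. l a x) \<and>
    continuous_map (sigma_topology As) (sigma_topology UNIV) (\<lambda>a. r x a)}"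

abbreviation pdual_left ::
    "'a::complex_banach_algebra \<Rightarrow> ('a, 'a) ptensor cdual \<Rightarrow> ('a, 'a) ptensor cdual"
  where "pdual_left \<equiv> dual_left ptensor_right"

abbreviation pdual_right ::
    "('a, 'a) ptensor cdual \<Rightarrow> 'a::complex_banach_algebra \<Rightarrow> ('a, 'a) ptensor cdual"
  where "pdual_right \<equiv> dual_right ptensor_left"

definition sigma_wc_ptensor_dual ::
    "'a::complex_banach_algebra cdual set \<Rightarrow> ('a, 'a) ptensor cdual set"
  where "sigma_wc_ptensor_dual As = sigma_wc As pdual_left pdual_right"

text \<open>\<open>\<pi>\<^bsub>\<sigma>wc\<^esub>\<close>, the adjoint of \<open>\<pi>\<^sup>*\<close> restricted to \<open>\<A>\<^sub>*\<close>.\<close>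

definition pi_sigma_wc ::
    "'a::complex_banach_algebra cdual set \<Rightarrow> (('a, 'a) ptensor cdual \<Rightarrow> complex) \<Rightarrow> 'a"
  where "pi_sigma_wc As \<phi> = of_predual_dual As (\<lambda>f\<in>As. \<phi> (cadjoint ptensor_prod f))"

text \<open>\<open>i\<^sup>*\<close> for the embedding \<open>i\<close> of \<open>\<A>\<^sub>*\<close> into \<open>\<A>\<^sup>*\<close>.\<close>

definition predual_embedding_adjoint ::
    "'a::complex_banach_algebra cdual set \<Rightarrow> 'a cdual cdual \<Rightarrow> 'a"
  where "predual_embedding_adjoint As \<Phi> = of_predual_dual As (\<lambda>f\<in>As. cdual_apply \<Phi> f)"

text \<open>Continuous bimodule morphisms from \<open>\<A>\<close> into the dual of a submodule \<open>S\<close> of \<open>E\<close>, where \<open>l\<close>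
  and \<open>r\<close> are the actions on \<open>E\<close>.\<close>

definition bimodule_morphism_dual_on ::
    "'e set \<Rightarrow> ('a \<Rightarrow> 'e \<Rightarrow> 'e) \<Rightarrow> ('e \<Rightarrow> 'a \<Rightarrow> 'e) \<Rightarrow>
     ('a::complex_banach_algebra \<Rightarrow> ('e::complex_normed_vector \<Rightarrow> complex)) \<Rightarrow> bool"
  where "bimodule_morphism_dual_on S l r \<rho> \<longleftrightarrow>
    (\<forall>a. \<rho> a \<in> dual_on S) \<and>
    (\<forall>a b. \<rho> (a + b) = (\<lambda>T\<in>S. \<rho> a T + \<rho> b T)) \<and>
    (\<forall>c a. \<rho> (c *\<^sub>C a) = (\<lambda>T\<in>S. c * \<rho> a T)) \<and>
    (\<exists>K. \<forall>a. dual_norm_on S (\<rho> a) \<le> K * norm a) \<and>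
    (\<forall>a b. \<rho> (a * b) = dual_left_on S r a (\<rho> b)) \<and>
    (\<forall>a b. \<rho> (a * b) = dual_right_on S l (\<rho> a) b)"


section \<open>Nets\<close>

definition directed_set :: "'i set \<Rightarrow> ('i \<Rightarrow> 'i \<Rightarrow> bool) \<Rightarrow> bool"
  where "directed_set I le \<longleftrightarrow> I \<noteq> {} \<and> (\<forall>i\<in>I. le i i) \<and>
    (\<forall>i\<in>I. \<forall>j\<in>I. \<forall>k\<in>I. le i j \<longrightarrow> le j k \<longrightarrow> le i k) \<and>
    (\<forall>i\<in>I. \<forall>j\<in>I. \<exists>k\<in>I. le i k \<and> le j k)"

definition net_filter :: "'i set \<Rightarrow> ('i \<Rightarrow> 'i \<Rightarrow> bool) \<Rightarrow> 'i filter"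
  where "net_filter I le = (INF i\<in>I. principal {j\<in>I. le i j})"

lemma eventually_net_filter:
  assumes "directed_set I le"
  shows "eventually P (net_filter I le) \<longleftrightarrow> (\<exists>i\<in>I. \<forall>j\<in>I. le i j \<longrightarrow> P j)"
proof -
  have trans: "le i j \<Longrightarrow> le j k \<Longrightarrow> le i k" if "i \<in> I" "j \<in> I" "k \<in> I" for i j k
    using assms that unfolding directed_set_def by blast
  have ub: "\<exists>k\<in>I. le i k \<and> le j k" if "i \<in> I" "j \<in> I" for i j
    using assms that unfolding directed_set_def by blast
  have "I \<noteq> {}" using assms unfolding directed_set_def by blast
  moreover have "\<exists>k\<in>I. principal {j\<in>I. le k j} \<le> inf (principal {j\<in>I. le a j}) (principal {j\<in>I. le b j})"
    if ab: "a \<in> I" "b \<in> I" for a b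
  proof -
    obtain k where k: "k \<in> I" "le a k" "le b k" using ub[OF ab] by blast
    have "{j\<in>I. le k j} \<subseteq> {j\<in>I. le a j} \<inter> {j\<in>I. le b j}"
      using trans[OF ab(1) k(1) _ k(2)] trans[OF ab(2) k(1) _ k(3)] by auto
    with k(1) show ?thesis by auto
  qed
  ultimately have "eventually P (net_filter I le) \<longleftrightarrow> (\<exists>i\<in>I. eventually P (principal {j\<in>I. le i j}))"
    unfolding net_filter_def by (rule eventually_INF_base)
  then show ?thesis by (auto simp: eventually_principal)
qed

text \<open>Higher-order logic cannot quantify over the type of the indices of a net. Nets with values
  in \<open>'x\<close> are taken with indices in the type \<open>'x set\<close>; by the following lemma this covers every net
  with values in \<open>'x\<close>, in that an arbitrary net can be replaced by one with such indices whose terms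
  are among those of the given net and which inherits all its limits.\<close>

lemma net_with_set_indices:
  fixes x :: "'i \<Rightarrow> 'x"
  assumes I: "directed_set I le"
  obtains J :: "'x set set" and le' y where "directed_set J le'" "y ` J \<subseteq> x ` I"
    "filtermap y (net_filter J le') \<le> filtermap x (net_filter I le)"
proof
  define tail where "tail = (\<lambda>i. x ` {j\<in>I. le i j})"
  define J where "J = tail ` I"
  define y where "y = (\<lambda>U. SOME u :: 'x. u \<in> U)"
  have y: "y (tail i) \<in> tail i" if "i \<in> I" for i
  proof -
    have "x i \<in> tail i" using I that by (auto simp: tail_def directed_set_def)
    then show ?thesis unfolding y_def by (rule someI)
  qed
  show J: "directed_set J (\<lambda>U V. V \<subseteq> U)"
    unfolding directed_set_def
  proof (intro conjI ballI impI)
    fix U V assume "U \<in> J" "V \<in> J"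
    then obtain i j where ij: "i \<in> I" "j \<in> I" "U = tail i" "V = tail j" by (auto simp: J_def)
    then obtain k where k: "k \<in> I" "le i k" "le j k" using I unfolding directed_set_def by blast
    have "tail k \<subseteq> U" "tail k \<subseteq> V"
      using I ij k unfolding tail_def directed_set_def by blast+
    with k show "\<exists>W\<in>J. W \<subseteq> U \<and> W \<subseteq> V" by (auto simp: J_def)
  qed (use I in \<open>auto simp: J_def directed_set_def\<close>)
  show "y ` J \<subseteq> x ` I" using y by (force simp: J_def tail_def)
  show "filtermap y (net_filter J (\<lambda>U V. V \<subseteq> U)) \<le> filtermap x (net_filter I le)"
  proof (rule filter_leI)
    fix P assume "eventually P (filtermap x (net_filter I le))"
    then obtain i where i: "i \<in> I" "\<And>j. j \<in> I \<Longrightarrow> le i j \<Longrightarrow> P (x j)"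
      by (auto simp: eventually_filtermap eventually_net_filter[OF I])
    have "P (y U)" if "U \<in> J" "U \<subseteq> tail i" for U
    proof -
      have "y U \<in> tail i" using that y by (auto simp: J_def)
      then show ?thesis using i by (auto simp: tail_def)
    qed
    then show "eventually P (filtermap y (net_filter J (\<lambda>U V. V \<subseteq> U)))"
      using i(1) unfolding eventually_filtermap eventually_net_filter[OF J]
      by (intro bexI[of _ "tail i"]) (auto simp: J_def)
  qed
qed


section \<open>Approximate Connes-biprojectivity and Johnson pseudo-Connes amenability\<close>

definition approximately_Connes_biprojective :: "'a::complex_banach_algebra cdual set \<Rightarrow> bool"
  where "approximately_Connes_biprojective As \<longleftrightarrow>
    (\<exists>(I :: ('a \<Rightarrow> ('a, 'a) ptensor cdual \<Rightarrow> complex) set set) le \<rho>.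
      directed_set I le \<and>
      (\<forall>\<alpha>\<in>I. bimodule_morphism_dual_on (sigma_wc_ptensor_dual As) pdual_left pdual_right (\<rho> \<alpha>)) \<and>
      (\<forall>a. ((\<lambda>\<alpha>. pi_sigma_wc As (\<rho> \<alpha> a)) \<longlongrightarrow> a) (net_filter I le)))"

definition Johnson_pseudo_Connes_amenable :: "'a::complex_banach_algebra cdual set \<Rightarrow> bool"
  where "Johnson_pseudo_Connes_amenable As \<longleftrightarrow>
    (\<exists>(I :: ('a, 'a) ptensor cdual cdual set set) le m.
      directed_set I le \<and>
      (\<forall>\<alpha>\<in>I. \<forall>a. \<forall>T\<in>sigma_wc_ptensor_dual As.
        cdual_apply (dual_left pdual_right a (m \<alpha>)) T =
        cdual_apply (dual_right pdual_left (m \<alpha>) a) T) \<and>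
      (\<forall>a. ((\<lambda>\<alpha>. predual_embedding_adjoint As (cadjoint (cadjoint ptensor_prod) (m \<alpha>)) * a)
        \<longlongrightarrow> a) (net_filter I le)))"

end

theory Submission
  imports Defs
begin

text \<open>An identity \<open>e\<close> turns a morphism \<open>\<rho>\<close> into the functional \<open>\<rho> e\<close> on \<open>\<sigma>wc(\<A> \<otimes> \<A>)\<^sup>*\<close>, which
  commutes with \<open>\<A>\<close> because \<open>a \<cdot> \<rho> e = \<rho> a = \<rho> e \<cdot> a\<close>; Hahn-Banach extends it to the whole of
  \<open>(\<A> \<otimes> \<A>)\<^sup>*\<close>. Conversely, an \<open>m\<close> commuting with \<open>\<A>\<close> on \<open>\<sigma>wc(\<A> \<otimes> \<A>)\<^sup>*\<close> gives the
  morphism \<open>a \<mapsto> a \<cdot> m\<close>, whose composition with \<open>\<pi>\<^bsub>\<sigma>wc\<^esub>\<close> is multiplication by the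
  element of \<open>\<A>\<close> that \<open>m\<close> induces on \<open>\<A>\<^sub>*\<close>.\<close>

section \<open>The Hahn-Banach theorem\<close>

text \<open>A partial functional is represented by its graph; the bound \<open>t \<le> K * norm x\<close> alone forces
  a graph that is a subspace to be single-valued.\<close>

definition dominated_graph :: "real \<Rightarrow> ('a::real_normed_vector \<times> real) set \<Rightarrow> bool"
  where "dominated_graph K G \<longleftrightarrow> subspace G \<and> (\<forall>(x, t)\<in>G. t \<le> K * norm x)"

text \<open>The difference of two values over the same point is a value over 0, where the bound is
  \<open>K * norm 0 = 0\<close>; exchanging the two values gives equality.\<close>

lemma dominated_graph_unique:
  assumes "dominated_graph K G" "(x, s) \<in> G" "(x, t) \<in> G"
  shows "s = t"
proof -
  have "v \<le> u" if "(x, u) \<in> G" "(x, v) \<in> G" for u v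
  proof -
    have "(x, v) - (x, u) \<in> G"
      using assms(1) that by (intro subspace_diff) (auto simp: dominated_graph_def)
    then have "v - u \<le> K * norm (0::'a)"
      using assms(1) by (auto simp: dominated_graph_def)
    then show ?thesis by simp
  qed
  then show ?thesis using assms(2,3) by (metis order_antisym)
qed

text \<open>The one-dimensional step of Hahn-Banach: \<open>c\<close> has to lie between all
  \<open>t - K * norm (x - z)\<close> and all \<open>K * norm (y + z) - s\<close>, and the triangle
  inequality puts the former below the latter. If \<open>z\<close> already has a value in
  \<open>G\<close>, the two constraints force \<open>c\<close> to be that value, so this case needs
  no separate treatment.\<close>

lemma dominated_graph_extend:
  fixes z :: "'a::real_normed_vector"
  assumes G: "dominated_graph K G" and K: "0 \<le> K"
  obtains c where "dominated_graph K (span (insert (z, c) G))"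
proof -
  have sub: "subspace G" and dom: "\<And>x t. (x, t) \<in> G \<Longrightarrow> t \<le> K * norm x"
    using G by (auto simp: dominated_graph_def)
  define A where "A = (\<lambda>(x, t). t - K * norm (x - z)) ` G"
  have sep: "t - K * norm (x - z) \<le> K * norm (y + z) - s" if "(x, t) \<in> G" "(y, s) \<in> G" for x t y s
  proof -
    have "(x + y, t + s) \<in> G" using subspace_add[OF sub that] by simp
    from dom[OF this] have "t + s \<le> K * norm (x + y)" .
    also have "\<dots> \<le> K * (norm (x - z) + norm (y + z))"
      using norm_triangle_ineq[of "x - z" "y + z"] K by (intro mult_left_mono) auto
    finally show ?thesis by (simp add: distrib_left)
  qed
  have 0: "(0, 0) \<in> G" using subspace_0[OF sub] by (simp add: zero_prod_def)
  have bdd: "bdd_above A" unfolding A_def by (rule bdd_aboveI2[of _ _ "K * norm (0 + z) - 0"])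
      (use sep[OF _ 0] in auto)
  have ne: "A \<noteq> {}" using 0 by (auto simp: A_def)
  define c where "c = Sup A"
  have lower: "t - K * norm (x - z) \<le> c" if "(x, t) \<in> G" for x t
    unfolding c_def by (rule cSup_upper[OF _ bdd]) (use that in \<open>force simp: A_def\<close>)
  have upper: "c \<le> K * norm (y + z) - s" if "(y, s) \<in> G" for y s
    unfolding c_def by (rule cSup_least[OF ne]) (use sep[OF _ that] in \<open>auto simp: A_def\<close>)
  have "t \<le> K * norm x" if "(x, t) \<in> span (insert (z, c) G)" for x t
  proof -
    obtain k where "(x, t) - k *\<^sub>R (z, c) \<in> span G"
      using \<open>(x, t) \<in> span (insert (z, c) G)\<close> unfolding span_breakdown_eq by blast
    then have k: "(x - k *\<^sub>R z, t - k * c) \<in> G"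
      unfolding span_eq_iff[THEN iffD2, OF sub] by simp
    \<comment> \<open>Dividing by the absolute value of \<open>k\<close> turns the point of
      \<open>k\<close> into \<open>x/k - z\<close> or \<open>z - x/k\<close>; then
      \<open>upper\<close> for positive \<open>k\<close>, or \<open>lower\<close> for negative
      \<open>k\<close>, leaves only a multiple of \<open>x\<close> inside the norm.\<close>
    consider "k = 0" | "k > 0" | "k < 0" by linarith
    then show ?thesis
    proof cases
      case 1
      then show ?thesis using dom[OF k] by simp
    next
      case 2
      have "((1/k) *\<^sub>R (x - k *\<^sub>R z), (1/k) * (t - k * c)) \<in> G"
        using subspace_scale[OF sub k, of "1/k"] by simp
      from upper[OF this] 2 have "c \<le> K * norm ((1/k) *\<^sub>R x) - (1/k) * (t - k * c)"
        by (simp add: scaleR_diff_right)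
      with 2 show ?thesis by (simp add: field_simps)
    next
      case 3
      have "((-1/k) *\<^sub>R (x - k *\<^sub>R z), (-1/k) * (t - k * c)) \<in> G"
        using subspace_scale[OF sub k, of "-1/k"] by simp
      from lower[OF this] 3 have "(-1/k) * (t - k * c) - K * norm ((-1/k) *\<^sub>R x) \<le> c"
        by (simp add: scaleR_diff_right)
      with 3 show ?thesis by (simp add: field_simps)
    qed
  qed
  then have "dominated_graph K (span (insert (z, c) G))"
    by (auto simp: dominated_graph_def)
  then show ?thesis by (rule that)
qed

text \<open>Two points of the union lie in a common member of the chain, which gives closure under
  addition. This supplies the upper bounds for Zorn's lemma.\<close>

lemma dominated_graph_Union:
  assumes C: "subset.chain {G. dominated_graph K G} C" and ne: "C \<noteq> {}"
  shows "dominated_graph K (\<Union>C)"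
proof -
  have G: "dominated_graph K G" if "G \<in> C" for G
    using C that by (auto simp: subset.chain_def)
  then have sub: "subspace G" if "G \<in> C" for G
    using that by (simp add: dominated_graph_def)
  have "p + q \<in> \<Union>C" if "G \<in> C" "H \<in> C" "p \<in> G" "q \<in> H" for p q G H
  proof -
    have "G \<subseteq> H \<or> H \<subseteq> G" using C that by (auto simp: subset_chain_def)
    then show ?thesis using that sub subspace_add by blast
  qed
  then have "subspace (\<Union>C)"
    using ne sub unfolding subspace_def[of "\<Union>C"] by (blast intro: subspace_0 subspace_scale)
  then show ?thesis using G by (fastforce simp: dominated_graph_def)
qed

text \<open>Zorn's lemma gives a maximal dominated graph above the graph of \<open>\<phi>\<close>.
  It is total by the one-dimensional step, and the function it describes is linear because the graph
  is a subspace. The one-sided bound at \<open>x\<close> and \<open>- x\<close> yields the bound on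
  the absolute value.\<close>

lemma real_Hahn_Banach:
  fixes \<phi> :: "'a::real_normed_vector \<Rightarrow> real"
  assumes S: "subspace S"
    and add: "\<And>x y. x \<in> S \<Longrightarrow> y \<in> S \<Longrightarrow> \<phi> (x + y) = \<phi> x + \<phi> y"
    and scale: "\<And>r x. x \<in> S \<Longrightarrow> \<phi> (r *\<^sub>R x) = r * \<phi> x"
    and dom: "\<And>x. x \<in> S \<Longrightarrow> \<phi> x \<le> K * norm x" and K: "0 \<le> K"
  obtains u where "linear u" "\<And>x. \<bar>u x\<bar> \<le> K * norm x" "\<And>x. x \<in> S \<Longrightarrow> u x = \<phi> x"
proof -
  let ?G = "(\<lambda>x. (x, \<phi> x)) ` S"
  have \<phi>0: "\<phi> 0 = 0" using scale[OF subspace_0[OF S], of 0] by simp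
  have "subspace ?G"
    unfolding subspace_def zero_prod_def
    using subspace_0[OF S] subspace_add[OF S] subspace_scale[OF S]
    by (auto simp: image_iff add scale \<phi>0)
  then have G: "dominated_graph K ?G" using dom by (auto simp: dominated_graph_def)
  let ?A = "{H. dominated_graph K H \<and> ?G \<subseteq> H}"
  have "\<exists>M\<in>?A. \<forall>X\<in>?A. M \<subseteq> X \<longrightarrow> X = M"
  proof (rule subset_Zorn_nonempty)
    show "?A \<noteq> {}" using G by blast
    show "\<Union>C \<in> ?A" if C: "C \<noteq> {}" "subset.chain ?A C" for C
    proof -
      have "subset.chain {H. dominated_graph K H} C" using C(2) by (auto simp: subset_chain_def)
      from dominated_graph_Union[OF this C(1)] have "dominated_graph K (\<Union>C)" .
      moreover have "?G \<subseteq> \<Union>C"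
      proof -
        obtain H where H: "H \<in> C" using C(1) by blast
        then have "H \<in> ?A" by (rule subsetD[OF conjunct1[OF C(2)[unfolded subset_chain_def]]])
        then have "?G \<subseteq> H" by simp
        then show ?thesis using Union_upper[OF H] by (rule order_trans)
      qed
      ultimately show ?thesis by simp
    qed
  qed
  then obtain M where M_mem: "M \<in> ?A" and M_max: "\<forall>X\<in>?A. M \<subseteq> X \<longrightarrow> X = M"
    by (rule bexE)
  have M: "dominated_graph K M" "?G \<subseteq> M" using M_mem by simp_all
  have max: "X = M" if "dominated_graph K X" "M \<subseteq> X" for X
    using M_max that order_trans[OF M(2) that(2)] by simp
  have sub: "subspace M" using M(1) by (simp add: dominated_graph_def)
  \<comment> \<open>Adjoining a point over \<open>x\<close> cannot enlarge \<open>M\<close>, so that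
    point was there already.\<close>
  have "\<exists>t. (x, t) \<in> M" for x
  proof -
    obtain c where c: "dominated_graph K (span (insert (x, c) M))"
      by (rule dominated_graph_extend[OF M(1) K])
    have "span (insert (x, c) M) = M"
      by (rule max[OF c]) (rule order_trans[OF subset_insertI span_superset])
    moreover have "(x, c) \<in> span (insert (x, c) M)" by (rule span_base) simp
    ultimately show ?thesis by auto
  qed
  then obtain u where u: "\<And>x. (x, u x) \<in> M" by metis
  have u_eq: "u x = t" if "(x, t) \<in> M" for x t
    by (rule dominated_graph_unique[OF M(1) u that])
  show ?thesis
  proof
    show lin: "linear u"
      by (rule linearI; rule u_eq)
        (use subspace_add[OF sub u u] subspace_scale[OF sub u] in simp_all)
    have le: "u x \<le> K * norm x" for x using M(1) u[of x] by (auto simp: dominated_graph_def)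
    show "\<bar>u x\<bar> \<le> K * norm x" for x using le[of x] le[of "- x"] linear_neg[OF lin, of x] by simp
    show "u x = \<phi> x" if "x \<in> S" for x by (rule u_eq) (use M(2) that in auto)
  qed
qed

lemma csubspace_imp_subspace: "csubspace S \<Longrightarrow> subspace S"
  by (auto simp: csubspace_def subspace_def scaleR_scaleC)

text \<open>A complex-linear functional is determined by its real part \<open>u\<close> through
  \<open>u x - \<i> * u (\<i> x)\<close>, so it suffices to extend the real part. Only boundedness
  is claimed for the extension, hence the crude constant \<open>2 * K\<close> below.\<close>

lemma complex_Hahn_Banach:
  assumes S: "csubspace S" and \<phi>: "\<phi> \<in> dual_on S"
  obtains f where "\<And>x. x \<in> S \<Longrightarrow> cdual_apply f x = \<phi> x"
proof -
  have add: "\<phi> (x + y) = \<phi> x + \<phi> y" if "x \<in> S" "y \<in> S" for x y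
    using \<phi> that by (simp add: dual_on_def)
  have scale: "\<phi> (c *\<^sub>C x) = c * \<phi> x" if "x \<in> S" for c x
    using \<phi> that by (simp add: dual_on_def)
  obtain K' where K': "\<And>x. x \<in> S \<Longrightarrow> cmod (\<phi> x) \<le> K' * norm x"
    using \<phi> unfolding dual_on_def by blast
  \<comment> \<open>The constant in \<open>dual_on\<close> may be negative when \<open>S\<close> is
    trivial, whereas the real theorem asks for a nonnegative one.\<close>
  define K where "K = \<bar>K'\<bar>"
  have K: "Re (\<phi> x) \<le> K * norm x" if "x \<in> S" for x
  proof -
    have "K' * norm x \<le> K * norm x" unfolding K_def by (rule mult_right_mono) auto
    then show ?thesis using K'[OF that] complex_Re_le_cmod[of "\<phi> x"] by linarith
  qed
  obtain u where u: "linear u" "\<And>x. \<bar>u x\<bar> \<le> K * norm x" "\<And>x. x \<in> S \<Longrightarrow> u x = Re (\<phi> x)"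
  proof (rule real_Hahn_Banach[OF csubspace_imp_subspace[OF S], of "\<lambda>x. Re (\<phi> x)" K])
    show "Re (\<phi> (r *\<^sub>R x)) = r * Re (\<phi> x)" if "x \<in> S" for r x
      using scale[OF that] by (simp add: scaleR_scaleC)
  qed (use K add in \<open>simp_all add: K_def\<close>)
  define g where "g = (\<lambda>x. complex_of_real (u x) - \<i> * complex_of_real (u (\<i> *\<^sub>C x)))"
  \<comment> \<open>Applied to \<open>c\<close> and to \<open>\<i> * c\<close>, this gives the
    complex homogeneity of \<open>g\<close>.\<close>
  have u_scaleC: "u (c *\<^sub>C x) = Re c * u x + Im c * u (\<i> *\<^sub>C x)" for c x
  proof -
    have "c *\<^sub>C x = Re c *\<^sub>R x + Im c *\<^sub>R (\<i> *\<^sub>C x)"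
      by (metis complex_eq mult.commute scaleC_add_left scaleC_scaleC scaleR_scaleC)
    then show ?thesis using u(1) by (simp add: linear_add linear_scale)
  qed
  have "bounded_clinear g"
  proof (rule bounded_clinearI)
    show "g (x + y) = g x + g y" for x y
      using u(1) by (simp add: g_def linear_add scaleC_add_right algebra_simps)
    show "g (c *\<^sub>C x) = c *\<^sub>C g x" for c x
      using u_scaleC[of c x] u_scaleC[of "\<i> * c" x]
      by (simp add: g_def scaleC_scaleC complex_eq_iff algebra_simps)
    show "cmod (g x) \<le> norm x * (2 * K)" for x
      using norm_triangle_ineq4[of "complex_of_real (u x)" "\<i> * complex_of_real (u (\<i> *\<^sub>C x))"]
        u(2)[of x] u(2)[of "\<i> *\<^sub>C x"]
      by (simp add: g_def norm_mult norm_scaleC) (simp add: algebra_simps)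
  qed
  moreover have "g x = \<phi> x" if "x \<in> S" for x
  proof -
    have "\<i> *\<^sub>C x \<in> S" using S that by (simp add: csubspace_def)
    then show ?thesis using that by (simp add: g_def u(3) scale complex_eq_iff)
  qed
  ultimately show ?thesis using that[of "Cdual g"] by (simp add: cdual_apply_Cdual)
qed


section \<open>The submodule \<open>\<sigma>wc\<close>\<close>

text \<open>A generated topology lives on the union of its generators; a single functional
  contributes the preimage of \<open>UNIV\<close>, while an empty \<open>F\<close> would leave the
  empty space.\<close>

lemma topspace_sigma_topology: "F \<noteq> {} \<Longrightarrow> topspace (sigma_topology F) = UNIV"
  unfolding sigma_topology_def topology_generated_by_topspace
  by (auto intro!: exI[of _ UNIV])

lemma continuous_map_sigma_topology_apply:
  assumes "f \<in> F"
  shows "continuous_map (sigma_topology F) euclidean (cdual_apply f)"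
proof -
  have "openin (sigma_topology F) (cdual_apply f -` U)" if "open U" for U
    unfolding sigma_topology_def by (rule topology_generated_by_Basis) (use assms that in blast)
  moreover have "topspace (sigma_topology F) = UNIV"
    using assms by (intro topspace_sigma_topology) auto
  ultimately show ?thesis by (simp add: continuous_map_def vimage_def)
qed

text \<open>The universal property of an initial topology.\<close>

lemma continuous_map_into_sigma_topology_iff:
  assumes "G \<noteq> {}"
  shows "continuous_map X (sigma_topology G) h \<longleftrightarrow>
    (\<forall>g\<in>G. continuous_map X euclidean (\<lambda>a. cdual_apply g (h a)))"
proof
  assume h: "continuous_map X (sigma_topology G) h"
  show "\<forall>g\<in>G. continuous_map X euclidean (\<lambda>a. cdual_apply g (h a))"
  proof
    fix g assume "g \<in> G"
    from continuous_map_compose[OF h continuous_map_sigma_topology_apply[OF this]]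
    show "continuous_map X euclidean (\<lambda>a. cdual_apply g (h a))" by (simp add: o_def)
  qed
next
  assume *: "\<forall>g\<in>G. continuous_map X euclidean (\<lambda>a. cdual_apply g (h a))"
  show "continuous_map X (sigma_topology G) h"
    unfolding sigma_topology_def
  proof (rule continuous_on_generated_topo)
    fix U assume "U \<in> {cdual_apply f -` V | f V. f \<in> G \<and> open V}"
    then obtain g V where U: "U = cdual_apply g -` V" and g: "g \<in> G" and V: "open V"
      by (elim CollectE exE conjE)
    have "openin X {a \<in> topspace X. cdual_apply g (h a) \<in> V}"
      by (rule openin_continuous_map_preimage[OF bspec[OF * g]]) (simp add: V)
    moreover have "{a \<in> topspace X. cdual_apply g (h a) \<in> V} = h -` U \<inter> topspace X"
      by (auto simp: U)
    ultimately show "openin X (h -` U \<inter> topspace X)" by simp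
  next
    have "topspace (sigma_topology G) = UNIV" by (rule topspace_sigma_topology[OF assms])
    then show "h ` topspace X \<subseteq> \<Union>{cdual_apply f -` V | f V. f \<in> G \<and> open V}"
      by (simp add: sigma_topology_def)
  qed
qed

text \<open>Replaces the weak topology of the module by scalar functions, one for each functional;
  all later membership proofs work in this form.\<close>

lemma sigma_wc_iff:
  "x \<in> sigma_wc As l r \<longleftrightarrow>
    (\<forall>\<Phi>. continuous_map (sigma_topology As) euclidean (\<lambda>a. cdual_apply \<Phi> (l a x)) \<and>
         continuous_map (sigma_topology As) euclidean (\<lambda>a. cdual_apply \<Phi> (r x a)))"
  by (auto simp: sigma_wc_def continuous_map_into_sigma_topology_iff)

section \<open>Adjoints, linearity of \<sigma>wc, and the actions on the dual and bidual of the
  projective tensor product\<close>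

lemma cadjoint_apply:
  "bounded_clinear T \<Longrightarrow> cdual_apply (cadjoint T f) x = cdual_apply f (T x)"
  unfolding cadjoint_def
  by (simp add: cdual_apply_Cdual bounded_clinear_compose[OF bounded_clinear_cdual_apply])

lemma bounded_clinear_cadjoint:
  assumes "bounded_clinear T"
  shows "bounded_clinear (cadjoint T)"
proof -
  obtain K where K: "0 \<le> K" "\<And>x. norm (T x) \<le> norm x * K"
    using bounded_clinear_bound[OF assms] by blast
  show ?thesis
  proof (rule bounded_clinearI)
    show "norm (cadjoint T f) \<le> norm f * K" for f
    proof (rule norm_cdual_le)
      show "cmod (cdual_apply (cadjoint T f) x) \<le> norm f * K * norm x" for x
        using cdual_apply_bound[of f "T x"] mult_left_mono[OF K(2)[of x] norm_ge_zero[of f]]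
        by (simp add: cadjoint_apply[OF assms] mult_ac)
    qed (use K in simp)
  qed (auto intro!: cdual_eqI simp: cadjoint_apply[OF assms] plus_cdual.rep_eq scaleC_cdual.rep_eq)
qed

lemma bounded_cbilinear_fix:
  assumes "bounded_cbilinear B"
  shows "bounded_clinear (B x)" "bounded_clinear (\<lambda>x. B x y)"
  using assms
  by (auto simp: bounded_cbilinear_def bounded_clinear_def
      intro: bounded_bilinear.bounded_linear_right bounded_bilinear.bounded_linear_left)

lemma csubspace_sigma_wc:
  assumes "banach_bimodule l r"
  shows "csubspace (sigma_wc As l r)"
proof -
  interpret banach_bimodule l r by fact
  have lin: "l a (x + y) = l a x + l a y" "r (x + y) a = r x a + r y a"
    "l a (c *\<^sub>C x) = c *\<^sub>C l a x" "r (c *\<^sub>C x) a = c *\<^sub>C r x a" for a x y c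
    using bounded_left bounded_right
    by (auto simp: bounded_cbilinear_def bounded_bilinear.add_left bounded_bilinear.add_right)
  have zero: "l a 0 = 0" "r 0 a = 0" "cdual_apply \<Phi> 0 = 0" for a and \<Phi> :: "'b cdual"
    using bounded_left bounded_right cdual_apply_scaleC[of \<Phi> 0 0]
    by (auto simp: bounded_cbilinear_def bounded_bilinear.zero_left bounded_bilinear.zero_right)
  have mult: "continuous_map X euclidean h \<Longrightarrow> continuous_map X euclidean (\<lambda>a. c * h a)"
    for X :: "'a topology" and h :: "'a \<Rightarrow> complex" and c
    by (simp add: continuous_map_atin tendsto_mult)
  show ?thesis
    unfolding csubspace_def sigma_wc_iff lin zero cdual_apply_add cdual_apply_scaleC
    by (intro conjI ballI allI continuous_map_add mult) (simp_all add: sigma_wc_iff)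
qed

lemma restrict_bidual_mem_dual_on: "csubspace S \<Longrightarrow> (\<lambda>f\<in>S. cdual_apply \<Phi> f) \<in> dual_on S"
  by (auto simp: dual_on_def csubspace_def cdual_apply_add cdual_apply_scaleC
      intro!: exI[of _ "norm \<Phi>"] cdual_apply_bound)

lemma pdual_apply:
  "cdual_apply (pdual_left a T) u = cdual_apply T (ptensor_right u (a :: 'a::complex_banach_algebra))"
  "cdual_apply (pdual_right T a) u = cdual_apply T (ptensor_left a u)"
proof -
  interpret banach_bimodule ptensor_left "ptensor_right :: _ \<Rightarrow> 'a \<Rightarrow> _"
    by (rule banach_bimodule_ptensor)
  show "cdual_apply (pdual_left a T) u = cdual_apply T (ptensor_right u a)"
    "cdual_apply (pdual_right T a) u = cdual_apply T (ptensor_left a u)"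
    by (simp_all add: cdual_apply_dual_left[OF bounded_right] cdual_apply_dual_right[OF bounded_left])
qed

lemma banach_bimodule_ptensor_dual:
  "banach_bimodule pdual_left (pdual_right :: _ \<Rightarrow> 'a::complex_banach_algebra \<Rightarrow> _)"
  by (rule banach_bimodule_dual[OF banach_bimodule_ptensor])

text \<open>Passing to the bidual swaps the sides again, so commuting with \<open>a\<close> means
  that \<open>m\<close> takes the same value at \<open>pdual_right T a\<close> and
  \<open>pdual_left a T\<close>.\<close>

lemma pbidual_apply:
  "cdual_apply (dual_left pdual_right a m) T = cdual_apply m (pdual_right T (a :: 'a::complex_banach_algebra))"
  "cdual_apply (dual_right pdual_left m a) T = cdual_apply m (pdual_left a T)"
proof -
  interpret banach_bimodule pdual_left "pdual_right :: _ \<Rightarrow> 'a \<Rightarrow> _"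
    by (rule banach_bimodule_ptensor_dual)
  show "cdual_apply (dual_left pdual_right a m) T = cdual_apply m (pdual_right T a)"
    "cdual_apply (dual_right pdual_left m a) T = cdual_apply m (pdual_left a T)"
    by (simp_all add: cdual_apply_dual_left[OF bounded_right] cdual_apply_dual_right[OF bounded_left])
qed

lemma csubspace_sigma_wc_ptensor_dual: "csubspace (sigma_wc_ptensor_dual As)"
  unfolding sigma_wc_ptensor_dual_def
  by (rule csubspace_sigma_wc[OF banach_bimodule_ptensor_dual])

section \<open>Weak* continuity of multiplication and the submodule property of \<sigma>wc\<close>

context
  fixes As :: "'a::complex_banach_algebra cdual set"
  assumes dual: "dual_banach_algebra As"
begin

text \<open>As a function of \<open>a\<close>, each translate is a functional obtained from
  \<open>f\<close> by a module action, and the predual is stable under both actions.\<close>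

lemma predual_translate:
  assumes "f \<in> As"
  shows "continuous_map (sigma_topology As) euclidean (\<lambda>a. cdual_apply f (a * b))"
    and "continuous_map (sigma_topology As) euclidean (\<lambda>a. cdual_apply f (b * a))"
proof -
  interpret banach_bimodule "(*)" "(*) :: 'a \<Rightarrow> _" by (rule banach_bimodule_algebra)
  have "dual_left (*) b f \<in> As" "dual_right (*) f b \<in> As"
    using dual assms by (auto simp: dual_banach_algebra_def)
  then have "continuous_map (sigma_topology As) euclidean (\<lambda>a. cdual_apply (dual_left (*) b f) a)"
    "continuous_map (sigma_topology As) euclidean (\<lambda>a. cdual_apply (dual_right (*) f b) a)"
    by (auto intro: continuous_map_sigma_topology_apply)
  then show "continuous_map (sigma_topology As) euclidean (\<lambda>a. cdual_apply f (a * b))"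
    "continuous_map (sigma_topology As) euclidean (\<lambda>a. cdual_apply f (b * a))"
    by (simp_all only: cdual_apply_dual_left[OF bounded_left] cdual_apply_dual_right[OF bounded_left])
qed

lemma predual_mult_continuous:
  "continuous_map (sigma_topology As) (sigma_topology As) (\<lambda>a. a * b)"
  "continuous_map (sigma_topology As) (sigma_topology As) (\<lambda>a. b * a)"
proof -
  have "As \<noteq> {}" using dual by (auto simp: dual_banach_algebra_def csubspace_def)
  then show "continuous_map (sigma_topology As) (sigma_topology As) (\<lambda>a. a * b)"
    "continuous_map (sigma_topology As) (sigma_topology As) (\<lambda>a. b * a)"
    by (simp_all add: continuous_map_into_sigma_topology_iff predual_translate)
qed

text \<open>When \<open>a\<close> and \<open>b\<close> act on the same side, associativity reduces
  the claim to the weak* continuity of multiplication by \<open>b\<close>. When they act on opposite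
  sides, the action of \<open>b\<close> comes last and is absorbed into the functional by its
  adjoint.\<close>

lemma sigma_wc_submodule:
  assumes "banach_bimodule l r" "x \<in> sigma_wc As l r"
  shows "l b x \<in> sigma_wc As l r" "r x b \<in> sigma_wc As l r"
proof -
  interpret banach_bimodule l r by fact
  have x: "continuous_map (sigma_topology As) euclidean (\<lambda>a. cdual_apply \<Phi> (l a x))"
    "continuous_map (sigma_topology As) euclidean (\<lambda>a. cdual_apply \<Phi> (r x a))" for \<Phi>
    using assms(2) by (auto simp: sigma_wc_iff)
  note mult = continuous_map_compose[OF predual_mult_continuous(1) x(1)]
    continuous_map_compose[OF predual_mult_continuous(2) x(2)]
  have "continuous_map (sigma_topology As) euclidean (\<lambda>a. cdual_apply \<Phi> (l b (r x a)))"
    "continuous_map (sigma_topology As) euclidean (\<lambda>a. cdual_apply \<Phi> (r (l a x) b))" for \<Phi>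
    using x(2)[of "cadjoint (l b) \<Phi>"] x(1)[of "cadjoint (\<lambda>x. r x b) \<Phi>"]
    by (simp_all add: cadjoint_apply bounded_cbilinear_fix[OF bounded_left]
        bounded_cbilinear_fix[OF bounded_right])
  then show "l b x \<in> sigma_wc As l r" "r x b \<in> sigma_wc As l r"
    using mult
    by (auto simp: sigma_wc_iff o_def left_assoc[symmetric] right_assoc[symmetric]
        middle_assoc[symmetric])
qed

section \<open>The algebra as the dual of its predual, and the product morphism\<close>

lemma canonical_map_of_predual_dual:
  "\<phi> \<in> dual_on As \<Longrightarrow> canonical_map As (of_predual_dual As \<phi>) = \<phi>"
  unfolding of_predual_dual_def using dual
  by (intro f_inv_into_f) (auto simp: dual_banach_algebra_def bij_betw_def)

lemma of_predual_dual_canonical_map: "of_predual_dual As (canonical_map As a) = a"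
  unfolding of_predual_dual_def using dual
  by (intro inv_into_f_f) (auto simp: dual_banach_algebra_def bij_betw_def)

text \<open>The restriction of \<open>\<Phi>\<close> to the predual is evaluation at a point, by
  surjectivity of the canonical map. This is the only form in which the inverse identification is
  used for bidual elements below.\<close>

lemma predual_embedding_adjoint_apply:
  assumes "f \<in> As"
  shows "cdual_apply f (predual_embedding_adjoint As \<Phi>) = cdual_apply \<Phi> f"
proof -
  have "csubspace As" using dual by (simp add: dual_banach_algebra_def)
  from canonical_map_of_predual_dual[OF restrict_bidual_mem_dual_on[OF this, of \<Phi>]]
  show ?thesis
    using assms unfolding predual_embedding_adjoint_def canonical_map_def
    by (metis (no_types, lifting) restrict_apply')
qed

lemmas prod_map = ptensor_prod[OF dual]

text \<open>Both sides are bounded and linear in \<open>u\<close>, so elementary tensors decide, and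
  there the claim is associativity.\<close>

lemma ptensor_prod_module:
  "ptensor_prod (ptensor_left a u) = a * ptensor_prod (u :: ('a, 'a) ptensor)"
  "ptensor_prod (ptensor_right u a) = ptensor_prod (u :: ('a, 'a) ptensor) * a"
proof -
  interpret banach_bimodule "(*)" "(*) :: 'a \<Rightarrow> _" by (rule banach_bimodule_algebra)
  note comp = bounded_clinear_compose
  show "ptensor_prod (ptensor_left a u) = a * ptensor_prod u"
    by (rule ptensor_map_eqI[THEN fun_cong, OF comp[OF prod_map(1) bounded_clinear_ptensor_left]
          comp[OF bounded_cbilinear_fix(1)[OF bounded_left] prod_map(1)]])
      (simp add: prod_map(2) ptensor_left_tensor mult.assoc)
  show "ptensor_prod (ptensor_right u a) = ptensor_prod u * a"
    by (rule ptensor_map_eqI[THEN fun_cong, OF comp[OF prod_map(1) bounded_clinear_ptensor_right]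
          comp[OF bounded_cbilinear_fix(2)[OF bounded_left] prod_map(1)]])
      (simp add: prod_map(2) ptensor_right_tensor mult.assoc)
qed

lemma ptensor_prod_adjoint_module:
  "cadjoint ptensor_prod (dual_left (*) a f) = pdual_left a (cadjoint ptensor_prod (f :: 'a cdual))"
  "cadjoint ptensor_prod (dual_right (*) f a) = pdual_right (cadjoint ptensor_prod (f :: 'a cdual)) a"
proof -
  interpret banach_bimodule "(*)" "(*) :: 'a \<Rightarrow> _" by (rule banach_bimodule_algebra)
  show "cadjoint ptensor_prod (dual_left (*) a f) = pdual_left a (cadjoint ptensor_prod f)"
    "cadjoint ptensor_prod (dual_right (*) f a) = pdual_right (cadjoint ptensor_prod f) a"
    by (auto intro!: cdual_eqI simp: cadjoint_apply[OF prod_map(1)] pdual_apply ptensor_prod_module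
        cdual_apply_dual_left[OF bounded_left] cdual_apply_dual_right[OF bounded_left])
qed

text \<open>Here \<open>\<sigma>wc(\<A>\<^sub>*) = \<A>\<^sub>*\<close> enters: on \<open>\<A>\<^sub>*\<close> a functional \<open>\<Phi>\<close> is evaluation at a point \<open>b\<close>
  of \<open>\<A>\<close>, so \<open>\<Phi>(a \<cdot> f) = f(ba)\<close> is wk*-continuous in \<open>a\<close>.\<close>

lemma ptensor_prod_adjoint_mem_sigma_wc:
  assumes f: "f \<in> As"
  shows "cadjoint ptensor_prod f \<in> sigma_wc_ptensor_dual As"
proof -
  interpret banach_bimodule "(*)" "(*) :: 'a \<Rightarrow> _" by (rule banach_bimodule_algebra)
  have mem: "dual_left (*) a f \<in> As" "dual_right (*) f a \<in> As" for a
    using dual f by (auto simp: dual_banach_algebra_def)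
  have "continuous_map (sigma_topology As) euclidean
      (\<lambda>a. cdual_apply \<Psi> (pdual_left a (cadjoint ptensor_prod f)))"
    "continuous_map (sigma_topology As) euclidean
      (\<lambda>a. cdual_apply \<Psi> (pdual_right (cadjoint ptensor_prod f) a))" for \<Psi>
  proof -
    \<comment> \<open>\<open>\<Phi>\<close> is \<open>\<Psi>\<close> composed with the adjoint of
      the product map, and \<open>b\<close> is the point representing it on the predual.\<close>
    define \<Phi> where "\<Phi> = cadjoint (cadjoint (ptensor_prod :: ('a, 'a) ptensor \<Rightarrow> 'a)) \<Psi>"
    define b where "b = predual_embedding_adjoint As \<Phi>"
    have "cdual_apply \<Psi> (cadjoint ptensor_prod g) = cdual_apply g b" if "g \<in> As" for g
      unfolding b_def predual_embedding_adjoint_apply[OF that] \<Phi>_def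
      by (simp add: cadjoint_apply bounded_clinear_cadjoint prod_map(1))
    from this[OF mem(1)] this[OF mem(2)]
    show "continuous_map (sigma_topology As) euclidean
        (\<lambda>a. cdual_apply \<Psi> (pdual_left a (cadjoint ptensor_prod f)))"
      "continuous_map (sigma_topology As) euclidean
        (\<lambda>a. cdual_apply \<Psi> (pdual_right (cadjoint ptensor_prod f) a))"
      by (simp_all add: ptensor_prod_adjoint_module[symmetric] predual_translate[OF f]
        cdual_apply_dual_left[OF bounded_left] cdual_apply_dual_right[OF bounded_left])
  qed
  then show ?thesis by (simp add: sigma_wc_ptensor_dual_def sigma_wc_iff)
qed

lemmas sigma_wc_ptensor_dual_submodule =
  sigma_wc_submodule[OF banach_bimodule_ptensor_dual, folded sigma_wc_ptensor_dual_def]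


section \<open>Morphisms and diagonals\<close>

abbreviation induced :: "('a, 'a) ptensor cdual cdual \<Rightarrow> 'a"
  where "induced m \<equiv> predual_embedding_adjoint As (cadjoint (cadjoint ptensor_prod) m)"

abbreviation commutes :: "('a, 'a) ptensor cdual cdual \<Rightarrow> bool"
  where "commutes m \<equiv> \<forall>a. \<forall>T\<in>sigma_wc_ptensor_dual As.
    cdual_apply (dual_left pdual_right a m) T = cdual_apply (dual_right pdual_left m a) T"

abbreviation morphism :: "('a \<Rightarrow> ('a, 'a) ptensor cdual \<Rightarrow> complex) \<Rightarrow> bool"
  where "morphism \<equiv> bimodule_morphism_dual_on (sigma_wc_ptensor_dual As) pdual_left pdual_right"

text \<open>Any extension of \<open>\<rho> e\<close> serves: \<sigma>wc is a submodule and contains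
  the image of the predual under the adjoint of the product map, so both conclusions evaluate
  \<open>m\<close> only where it agrees with \<open>\<rho> e\<close>.\<close>

lemma diagonal_of_morphism:
  assumes \<rho>: "morphism \<rho>" and e: "\<And>a. e * a = a" "\<And>a. a * e = a"
  obtains m where "commutes m" "induced m = pi_sigma_wc As (\<rho> e)"
proof -
  have "\<rho> e \<in> dual_on (sigma_wc_ptensor_dual As)"
    using \<rho> by (simp add: bimodule_morphism_dual_on_def)
  then obtain m where m: "\<And>T. T \<in> sigma_wc_ptensor_dual As \<Longrightarrow> cdual_apply m T = \<rho> e T"
    by (rule complex_Hahn_Banach[OF csubspace_sigma_wc_ptensor_dual]) blast
  have l: "\<rho> a = dual_left_on (sigma_wc_ptensor_dual As) pdual_right a (\<rho> e)"
    and r: "\<rho> a = dual_right_on (sigma_wc_ptensor_dual As) pdual_left (\<rho> e) a" for a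
    using \<rho> e unfolding bimodule_morphism_dual_on_def by metis+
  \<comment> \<open>Both sides are \<open>\<rho> a T\<close>, by the left and the right module
    law.\<close>
  have "\<rho> e (pdual_right T a) = \<rho> e (pdual_left a T)" if "T \<in> sigma_wc_ptensor_dual As" for a T
    using fun_cong[OF l[of a], of T] fun_cong[OF r[of a], of T] that
    by (simp add: dual_left_on_def dual_right_on_def)
  then have "commutes m"
    by (simp add: pbidual_apply m sigma_wc_ptensor_dual_submodule)
  moreover have "induced m = pi_sigma_wc As (\<rho> e)"
    unfolding predual_embedding_adjoint_def pi_sigma_wc_def
    by (rule arg_cong[of _ _ "of_predual_dual As"])
      (auto simp: restrict_def cadjoint_apply bounded_clinear_cadjoint prod_map(1) m
        ptensor_prod_adjoint_mem_sigma_wc)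
  ultimately show ?thesis by (rule that)
qed

text \<open>Here \<open>\<rho> a\<close> is the restriction of \<open>a \<cdot> m\<close>. Its left
  module law is associativity of the action; the right one needs that \<open>m\<close> commutes,
  applied at \<open>pdual_right T a\<close>, which is again in \<sigma>wc.\<close>

lemma morphism_of_diagonal:
  assumes m: "commutes m"
  defines "\<rho> \<equiv> \<lambda>a. \<lambda>T\<in>sigma_wc_ptensor_dual As. cdual_apply m (pdual_right T a)"
  shows "morphism \<rho>" "pi_sigma_wc As (\<rho> a) = induced m * a"
proof -
  let ?S = "sigma_wc_ptensor_dual As"
  interpret banach_bimodule pdual_left "pdual_right :: _ \<Rightarrow> 'a \<Rightarrow> _"
    by (rule banach_bimodule_ptensor_dual)
  interpret A: banach_bimodule "(*)" "(*) :: 'a \<Rightarrow> _" by (rule banach_bimodule_algebra)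
  note sub = sigma_wc_ptensor_dual_submodule
  have comm: "cdual_apply m (pdual_right T a) = cdual_apply m (pdual_left a T)" if "T \<in> ?S" for a T
    using m that by (simp add: pbidual_apply)
  have \<rho>_bidual: "\<rho> a = (\<lambda>T\<in>?S. cdual_apply (dual_left pdual_right a m) T)" for a
    by (simp add: \<rho>_def pbidual_apply)
  obtain K where K: "\<And>a. norm (dual_left pdual_right a m) \<le> norm a * norm m * K"
    by (rule bounded_cbilinear_bound[OF banach_bimodule.bounded_left[OF
          banach_bimodule_dual[OF banach_bimodule_ptensor_dual]]]) (rule that)
  \<comment> \<open>Makes the index set of the supremum in \<open>dual_norm_on\<close>
    nonempty.\<close>
  have 0: "0 \<in> ?S" using csubspace_sigma_wc_ptensor_dual[of As] by (simp add: csubspace_def)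
  have norm: "dual_norm_on ?S (\<rho> a) \<le> norm m * K * norm a" for a
    unfolding dual_norm_on_def
  proof (rule cSUP_least)
    fix T assume T: "T \<in> {T \<in> ?S. norm T \<le> 1}"
    have "cmod (\<rho> a T) \<le> norm (dual_left pdual_right a m) * norm T"
      using T cdual_apply_bound by (simp add: \<rho>_bidual)
    also have "\<dots> \<le> norm (dual_left pdual_right a m)"
      using T by (simp add: mult_left_le)
    finally show "cmod (\<rho> a T) \<le> norm m * K * norm a" using K[of a] by (simp add: mult_ac)
  qed (use 0 in \<open>auto intro!: exI[of _ 0]\<close>)
  have lin: "pdual_right T (a + b) = pdual_right T a + pdual_right T b"
    "pdual_right T (c *\<^sub>C a) = c *\<^sub>C pdual_right T a" for T and a b :: 'a and c
    using bounded_right by (auto simp: bounded_cbilinear_def bounded_bilinear.add_right)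
  show "morphism \<rho>"
    unfolding bimodule_morphism_dual_on_def
  proof (intro conjI allI)
    show "\<rho> a \<in> dual_on ?S" for a
      unfolding \<rho>_bidual by (rule restrict_bidual_mem_dual_on[OF csubspace_sigma_wc_ptensor_dual])
    show "\<exists>K. \<forall>a. dual_norm_on ?S (\<rho> a) \<le> K * norm a" using norm by blast
    show "\<rho> (a + b) = (\<lambda>T\<in>?S. \<rho> a T + \<rho> b T)" for a b
      by (auto simp: \<rho>_def restrict_def fun_eq_iff lin cdual_apply_add)
    show "\<rho> (c *\<^sub>C a) = (\<lambda>T\<in>?S. c * \<rho> a T)" for a c
      by (auto simp: \<rho>_def restrict_def fun_eq_iff lin cdual_apply_scaleC)
    show "\<rho> (a * b) = dual_left_on ?S pdual_right a (\<rho> b)" for a b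
      by (auto simp: \<rho>_def dual_left_on_def restrict_def fun_eq_iff right_assoc sub)
    show "\<rho> (a * b) = dual_right_on ?S pdual_left (\<rho> a) b" for a b
      by (auto simp: \<rho>_def dual_right_on_def restrict_def fun_eq_iff right_assoc sub comm
          middle_assoc[symmetric])
  qed
  have "(\<lambda>f\<in>As. \<rho> a (cadjoint ptensor_prod f)) = canonical_map As (induced m * a)"
    unfolding canonical_map_def
  proof (rule restrict_ext)
    fix f assume f: "f \<in> As"
    have af: "dual_left (*) a f \<in> As" using dual f by (auto simp: dual_banach_algebra_def)
    \<comment> \<open>Commutation moves \<open>a\<close> to the other side of the pulled-back
      functional, so that the product comes out as \<open>induced m * a\<close> and not
      \<open>a * induced m\<close>.\<close>
    have "\<rho> a (cadjoint ptensor_prod f) = cdual_apply m (cadjoint ptensor_prod (dual_left (*) a f))"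
      by (simp add: \<rho>_def ptensor_prod_adjoint_mem_sigma_wc[OF f] comm ptensor_prod_adjoint_module)
    also have "\<dots> = cdual_apply (dual_left (*) a f) (induced m)"
      by (simp add: predual_embedding_adjoint_apply[OF af] cadjoint_apply bounded_clinear_cadjoint prod_map(1))
    also have "\<dots> = cdual_apply f (induced m * a)"
      by (rule cdual_apply_dual_left[OF A.bounded_right])
    finally show "\<rho> a (cadjoint ptensor_prod f) = cdual_apply f (induced m * a)" .
  qed
  then show "pi_sigma_wc As (\<rho> a) = induced m * a"
    by (simp add: pi_sigma_wc_def of_predual_dual_canonical_map)
qed

end

section \<open>Limits along nets and the two implications\<close>

lemma eventually_mem_net_filter:
  assumes "directed_set I le"
  shows "\<forall>\<^sub>F \<alpha> in net_filter I le. \<alpha> \<in> I"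
proof -
  have "I \<noteq> {}" using assms by (simp add: directed_set_def)
  then show ?thesis by (auto simp: eventually_net_filter[OF assms])
qed

text \<open>Carries limits over to the net produced by \<open>net_with_set_indices\<close>, for
  quantities depending only on the term of the net.\<close>

lemma tendsto_reindexed_net:
  assumes "filtermap y F \<le> filtermap x G" "((\<lambda>i. h (x i)) \<longlongrightarrow> L) G"
  shows "((\<lambda>j. h (y j)) \<longlongrightarrow> L) F"
  using assms tendsto_mono[of "filtermap y F" "filtermap x G" h L]
  by (simp add: filterlim_filtermap)

lemma approximately_Connes_biprojective_imp_Johnson_pseudo_Connes_amenable:
  fixes As :: "'a::complex_banach_algebra cdual set"
  assumes dual: "dual_banach_algebra As" and bi: "approximately_Connes_biprojective As"
    and e: "\<And>a::'a. e * a = a" "\<And>a. a * e = a"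
  shows "Johnson_pseudo_Connes_amenable As"
proof -
  obtain I :: "('a \<Rightarrow> ('a, 'a) ptensor cdual \<Rightarrow> complex) set set" and le \<rho> where
    I: "directed_set I le" and
    \<rho>: "\<And>\<alpha>. \<alpha> \<in> I \<Longrightarrow>
      bimodule_morphism_dual_on (sigma_wc_ptensor_dual As) pdual_left pdual_right (\<rho> \<alpha>)" and
    lim: "\<And>a. ((\<lambda>\<alpha>. pi_sigma_wc As (\<rho> \<alpha> a)) \<longlongrightarrow> a) (net_filter I le)"
    using bi unfolding approximately_Connes_biprojective_def by blast
  let ?ind = "\<lambda>m. predual_embedding_adjoint As (cadjoint (cadjoint ptensor_prod) m)"
  let ?com = "\<lambda>m. \<forall>a. \<forall>T\<in>sigma_wc_ptensor_dual As.
    cdual_apply (dual_left pdual_right a m) T = cdual_apply (dual_right pdual_left m a) T"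
  have "\<forall>\<alpha>. \<exists>m. \<alpha> \<in> I \<longrightarrow> ?com m \<and> ?ind m = pi_sigma_wc As (\<rho> \<alpha> e)"
    using diagonal_of_morphism[OF dual \<rho> e] by metis
  then obtain m where m: "\<And>\<alpha>. \<alpha> \<in> I \<Longrightarrow> ?com (m \<alpha>)"
      "\<And>\<alpha>. \<alpha> \<in> I \<Longrightarrow> ?ind (m \<alpha>) = pi_sigma_wc As (\<rho> \<alpha> e)"
    by metis
  have ev: "\<forall>\<^sub>F \<alpha> in net_filter I le. \<alpha> \<in> I"
    by (rule eventually_mem_net_filter[OF I])
  \<comment> \<open>Convergence at \<open>e\<close>, multiplied on the right by \<open>a\<close>,
    gives convergence at every \<open>a\<close>.\<close>
  have lim': "((\<lambda>\<alpha>. ?ind (m \<alpha>) * a) \<longlongrightarrow> a) (net_filter I le)" for a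
  proof -
    have "((\<lambda>\<alpha>. pi_sigma_wc As (\<rho> \<alpha> e) * a) \<longlongrightarrow> e * a) (net_filter I le)"
      by (intro tendsto_mult lim tendsto_const)
    then have "((\<lambda>\<alpha>. pi_sigma_wc As (\<rho> \<alpha> e) * a) \<longlongrightarrow> a) (net_filter I le)"
      by (simp add: e)
    then show ?thesis
      by (rule Lim_transform_eventually) (use ev in eventually_elim, simp add: m)
  qed
  \<comment> \<open>The indices inherited from \<open>\<rho>\<close> are sets of maps, while the
    definition asks for sets of bidual elements; hence the change of index set.\<close>
  obtain J :: "('a, 'a) ptensor cdual cdual set set" and le' y where
    J: "directed_set J le'" and y: "y ` J \<subseteq> m ` I"
      "filtermap y (net_filter J le') \<le> filtermap m (net_filter I le)"
    by (rule net_with_set_indices[OF I])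
  have com: "?com (y \<alpha>)" if "\<alpha> \<in> J" for \<alpha>
  proof -
    have "y \<alpha> \<in> m ` I" by (rule subsetD[OF y(1) imageI[OF that]])
    then obtain \<beta> where "\<beta> \<in> I" "y \<alpha> = m \<beta>" by (rule imageE)
    then show ?thesis using m(1) by simp
  qed
  have "((\<lambda>\<alpha>. ?ind (y \<alpha>) * a) \<longlongrightarrow> a) (net_filter J le')" for a
    by (rule tendsto_reindexed_net[OF y(2), of "\<lambda>m. ?ind m * a"]) (rule lim')
  then show ?thesis
    unfolding Johnson_pseudo_Connes_amenable_def
    by (intro exI[of _ J] exI[of _ le'] exI[of _ y] conjI J ballI allI com[rule_format])
qed

lemma Johnson_pseudo_Connes_amenable_imp_approximately_Connes_biprojective:
  fixes As :: "'a::complex_banach_algebra cdual set"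
  assumes dual: "dual_banach_algebra As" and am: "Johnson_pseudo_Connes_amenable As"
  shows "approximately_Connes_biprojective As"
proof -
  let ?ind = "\<lambda>m. predual_embedding_adjoint As (cadjoint (cadjoint ptensor_prod) m)"
  let ?com = "\<lambda>m. \<forall>a. \<forall>T\<in>sigma_wc_ptensor_dual As.
    cdual_apply (dual_left pdual_right a m) T = cdual_apply (dual_right pdual_left m a) T"
  let ?mor = "bimodule_morphism_dual_on (sigma_wc_ptensor_dual As) pdual_left pdual_right"
  obtain I :: "('a, 'a) ptensor cdual cdual set set" and le m where
    I: "directed_set I le" and m: "\<And>\<alpha>. \<alpha> \<in> I \<Longrightarrow> ?com (m \<alpha>)" and
    lim: "\<And>a. ((\<lambda>\<alpha>. ?ind (m \<alpha>) * a) \<longlongrightarrow> a) (net_filter I le)"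
    using am unfolding Johnson_pseudo_Connes_amenable_def by blast
  define \<rho> where
    "\<rho> = (\<lambda>\<alpha> a. \<lambda>T\<in>sigma_wc_ptensor_dual As. cdual_apply (m \<alpha>) (pdual_right T a))"
  have \<rho>: "?mor (\<rho> \<alpha>)" "pi_sigma_wc As (\<rho> \<alpha> a) = ?ind (m \<alpha>) * a" if "\<alpha> \<in> I" for \<alpha> a
    unfolding \<rho>_def using morphism_of_diagonal[OF dual m[OF that]] by auto
  have ev: "\<forall>\<^sub>F \<alpha> in net_filter I le. \<alpha> \<in> I"
    by (rule eventually_mem_net_filter[OF I])
  have lim': "((\<lambda>\<alpha>. pi_sigma_wc As (\<rho> \<alpha> a)) \<longlongrightarrow> a) (net_filter I le)" for a
    by (rule Lim_transform_eventually[OF lim[of a]]) (use ev in eventually_elim, simp add: \<rho>)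
  \<comment> \<open>The same change of index type in the opposite direction.\<close>
  obtain J :: "('a \<Rightarrow> ('a, 'a) ptensor cdual \<Rightarrow> complex) set set" and le' y where
    J: "directed_set J le'" and y: "y ` J \<subseteq> \<rho> ` I"
      "filtermap y (net_filter J le') \<le> filtermap \<rho> (net_filter I le)"
    by (rule net_with_set_indices[OF I])
  have mor: "?mor (y \<alpha>)" if "\<alpha> \<in> J" for \<alpha>
  proof -
    have "y \<alpha> \<in> \<rho> ` I" by (rule subsetD[OF y(1) imageI[OF that]])
    then obtain \<beta> where "\<beta> \<in> I" "y \<alpha> = \<rho> \<beta>" by (rule imageE)
    then show ?thesis using \<rho>(1) by simp
  qed
  have "((\<lambda>\<alpha>. pi_sigma_wc As (y \<alpha> a)) \<longlongrightarrow> a) (net_filter J le')" for a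
    by (rule tendsto_reindexed_net[OF y(2), of "\<lambda>\<rho>. pi_sigma_wc As (\<rho> a)"]) (rule lim')
  then show ?thesis
    unfolding approximately_Connes_biprojective_def
    by (intro exI[of _ J] exI[of _ le'] exI[of _ y] conjI J ballI allI mor)
qed

theorem theorem2p2:
  fixes As :: "'a::complex_banach_algebra cdual set"
  assumes "dual_banach_algebra As"
  shows "(approximately_Connes_biprojective As \<and> (\<exists>e::'a. \<forall>a. e * a = a \<and> a * e = a) \<longrightarrow>
          Johnson_pseudo_Connes_amenable As) \<and>
         (Johnson_pseudo_Connes_amenable As \<longrightarrow> approximately_Connes_biprojective As)"
  using approximately_Connes_biprojective_imp_Johnson_pseudo_Connes_amenable[OF assms]
    Johnson_pseudo_Connes_amenable_imp_approximately_Connes_biprojective[OF assms]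
  by blast

end
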